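(* There is no algorithm in the read/write streams model that uses $O(1)$ streams, $\log^{O(1)} n$ bits of internal memory and $o(\log n)$ passes and that computes the Burrows–Wheeler Transform of every input string of length $n$.
   Context: Read/write streams model: an algorithm has an internal memory of $m$ bits and access to a fixed number of streams (tapes); each stream is a sequence of cells accessed sequentially by a read/write head; a pass is one sequential sweep over a stream. The input string is initially on the first stream. Burrows–Wheeler Transform (BWT): append to $s$ a special character \$ lexicographically smaller than every alphabet character; the BWT is the string obtained by listing, for each suffix of $s\$$ in lexicographic order, the character immediately preceding that suffix (cyclically). *)

theory Defs
  imports Complex_Main "HOL-Library.Landau_Symbols" "HOL-Library.List_Lexorder"
    "HOL-Library.Option_ord"
begin

(* The end marker $ is None: Option_ord makes it smaller than every Some c, and List_Lexorder
   orders lists lexicographically. A string over the alphabet with $ has type 'a option list. *)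
definition bwt :: "'a::linorder list \<Rightarrow> 'a option list" where
  "bwt s = (let w = map Some s @ [None] in
     map (\<lambda>i. if i = 0 then last w else w ! (i - 1))
       (sort_key (\<lambda>i. drop i w) [0..<length w]))"

(* Work symbols come from a type 'g, which is required to be finite wherever algorithms are
   quantified over: the set of cell contents does not depend on the input length. *)
datatype ('a, 'g) cell = Blank | Sym "'a option" | Work 'g

datatype move = Left | Right | Stay

(* The internal memory is a bit string and the transition is an arbitrary function of its
   contents and of the list of cells under the heads (one for each stream), so that the
   number of bits is the only restriction on internal computation. The initial memory may
   depend on the input length. A transition returns the new memory and, for each stream, the
   symbol to write and the move to make afterwards; None means halting. *)
record ('a, 'g) rw_algorithm =
  num_streams :: nat
  output_stream :: nat
  initial_memory :: "nat \<Rightarrow> bool list"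
  transition :: "bool list \<Rightarrow> ('a, 'g) cell list \<Rightarrow>
    (bool list \<times> (nat \<Rightarrow> ('a, 'g) cell \<times> move)) option"

(* heading is the direction of the current sweep (Stay before the first one) and num_passes
   counts the sweeps begun so far, both for each stream. *)
record ('a, 'g) rw_config =
  memory :: "bool list"
  stream :: "nat \<Rightarrow> nat \<Rightarrow> ('a, 'g) cell"
  position :: "nat \<Rightarrow> nat"
  heading :: "nat \<Rightarrow> move"
  num_passes :: "nat \<Rightarrow> nat"

definition stream_of :: "'a option list \<Rightarrow> nat \<Rightarrow> ('a, 'g) cell" where
  "stream_of w i = (if i < length w then Sym (w ! i) else Blank)"

definition initial_config :: "('a, 'g) rw_algorithm \<Rightarrow> 'a list \<Rightarrow> ('a, 'g) rw_config" where
  "initial_config A s =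
     \<lparr> memory = initial_memory A (length s),
       stream = (\<lambda>j. if j = 0 then stream_of (map Some s) else (\<lambda>_. Blank)),
       position = (\<lambda>_. 0),
       heading = (\<lambda>_. Stay),
       num_passes = (\<lambda>_. 0) \<rparr>"

fun move_head :: "move \<Rightarrow> nat \<Rightarrow> nat" where
  "move_head Left p = p - 1"
| "move_head Right p = p + 1"
| "move_head Stay p = p"

definition starts_pass :: "move \<Rightarrow> move \<Rightarrow> bool" where
  "starts_pass old d \<longleftrightarrow> d \<noteq> Stay \<and> d \<noteq> old"

definition transition_at ::
    "('a, 'g) rw_algorithm \<Rightarrow> ('a, 'g) rw_config \<Rightarrow>
      (bool list \<times> (nat \<Rightarrow> ('a, 'g) cell \<times> move)) option" where
  "transition_at A C =
     transition A (memory C) (map (\<lambda>j. stream C j (position C j)) [0..<num_streams A])"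

definition halted :: "('a, 'g) rw_algorithm \<Rightarrow> ('a, 'g) rw_config \<Rightarrow> bool" where
  "halted A C \<longleftrightarrow> transition_at A C = None"

definition next_config ::
    "('a, 'g) rw_algorithm \<Rightarrow> ('a, 'g) rw_config \<Rightarrow> ('a, 'g) rw_config" where
  "next_config A C =
     (case transition_at A C of
        None \<Rightarrow> C
      | Some (q, act) \<Rightarrow>
          \<lparr> memory = q,
            stream = (\<lambda>j. if j < num_streams A
              then (stream C j)(position C j := fst (act j)) else stream C j),
            position = (\<lambda>j. if j < num_streams A
              then move_head (snd (act j)) (position C j) else position C j),
            heading = (\<lambda>j. if j < num_streams A \<and> starts_pass (heading C j) (snd (act j))
              then snd (act j) else heading C j),
            num_passes = (\<lambda>j. if j < num_streams A \<and> starts_pass (heading C j) (snd (act j))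
              then num_passes C j + 1 else num_passes C j) \<rparr>)"

definition config_after ::
    "('a, 'g) rw_algorithm \<Rightarrow> 'a list \<Rightarrow> nat \<Rightarrow> ('a, 'g) rw_config" where
  "config_after A s k = (next_config A ^^ k) (initial_config A s)"

definition uses_memory :: "('a, 'g) rw_algorithm \<Rightarrow> (nat \<Rightarrow> nat) \<Rightarrow> bool" where
  "uses_memory A m \<longleftrightarrow> (\<forall>s k. length (memory (config_after A s k)) \<le> m (length s))"

definition uses_passes :: "('a, 'g) rw_algorithm \<Rightarrow> (nat \<Rightarrow> nat) \<Rightarrow> bool" where
  "uses_passes A r \<longleftrightarrow>
     (\<forall>s k. (\<Sum>j<num_streams A. num_passes (config_after A s k) j) \<le> r (length s))"

definition computes ::
    "('a, 'g) rw_algorithm \<Rightarrow> ('a list \<Rightarrow> 'a option list) \<Rightarrow> bool" where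
  "computes A f \<longleftrightarrow>
     output_stream A < num_streams A \<and>
     (\<forall>s. \<exists>k. halted A (config_after A s k) \<and>
        stream (config_after A s k) (output_stream A) = stream_of (f s))"

end

theory Submission
  imports Defs "HOL-Real_Asymp.Real_Asymp"
begin

text \<open>
  The BWT is made to transpose a matrix of blocks. Take \<open>a\<^sup>2\<close> blocks of \<open>a\<^sup>3\<close> payload letters each,
  and let every payload letter be followed by a key that fixes the rank of the suffix behind it; then
  the payload appears in the BWT in any prescribed order.

  Cut a run into segments between events, where an event is the start of a pass or the moment at which
  a head enters tape content of another origin. Tag each cell by the set of input blocks on which it
  can depend once the event times and the memory, head positions and scanned cells at these times (the
  trace) are known. In one pass the tags on a tape are composed of earlier tags along monotone head
  motions, so after \<open>r\<close> passes the tags on each tape are covered by \<open>O(t)\<^sup>r\<close> monotone chains of (cell,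
  block) pairs, and there are \<open>O(t)\<^sup>r a\<^sup>2\<close> events. A monotone chain meets the transposed order of the
  blocks in at most \<open>2 a\<close> places, so for \<open>r = o(log n)\<close> some block \<open>i\<close> is copied to an output region with
  no tag \<open>i\<close>. Hence, given the trace, block \<open>i\<close> is a function of the other blocks, which forces at least
  \<open>2\<close> to the \<open>a\<^sup>3\<close> different traces. As a run lasts only quasi-polynomially many steps, a trace is
  described by \<open>a\<^sup>2 n\<^bsup>o(1)\<^esup>\<close> bits, which is too few.
\<close>

subsection \<open>Tags and monotone chains\<close>

text \<open>Heads move as the data dictate and the internal computation is arbitrary, so no region
  of a stream belongs to an input block in advance, and the memory can carry information anywhere.
  Information carried by the memory is therefore charged to the trace, and tags account only for
  what travels through cells. The tags are themselves functions of the trace; hence one block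
  \<open>i\<close> serves all inputs that share a trace.

  A matrix transposition is used because no monotone chain can follow more than \<open>O(a)\<close>
  of its \<open>a^2\<close> blocks, so that fewer than \<open>a / 2\<close> chains must miss one.
  The block length \<open>a^3\<close> leaves a factor \<open>a\<close> over the roughly
  \<open>a^2\<close> snapshots of a trace, which pays for the \<open>n^o(1)\<close> factors. Only
  two letters are available, hence keys are written in unary; with \<open>a^5\<close> items this
  gives \<open>n = a^5 * (a^5 + 6)\<close>, still polynomial in \<open>a\<close>, so that
  \<open>o(log n)\<close> passes are \<open>o(log a)\<close> passes.

  Steps are not limited by the model, yet snapshots contain times and head positions. A bound on the
  running time comes from the memory: a long stretch in which the heads learn nothing new repeats a
  view and never ends.\<close>

definition monotonic_on :: "nat set \<Rightarrow> (nat \<Rightarrow> nat) \<Rightarrow> bool" where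
  "monotonic_on H f \<longleftrightarrow> (\<forall>x\<in>H. \<forall>y\<in>H. x \<le> y \<longrightarrow> f x \<le> f y) \<or> (\<forall>x\<in>H. \<forall>y\<in>H. x \<le> y \<longrightarrow> f y \<le> f x)"

lemma monotonic_on_compose:
  assumes "monotonic_on H f" "monotonic_on H' g" "f ` H \<subseteq> H'"
  shows "monotonic_on H (\<lambda>x. g (f x))"
  using assms(1) unfolding monotonic_on_def
proof
  assume f: "\<forall>x\<in>H. \<forall>y\<in>H. x \<le> y \<longrightarrow> f x \<le> f y"
  from assms(2) show "(\<forall>x\<in>H. \<forall>y\<in>H. x \<le> y \<longrightarrow> g (f x) \<le> g (f y)) \<or> (\<forall>x\<in>H. \<forall>y\<in>H. x \<le> y \<longrightarrow> g (f y) \<le> g (f x))"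
    unfolding monotonic_on_def using f assms(3) by (meson image_subset_iff)
next
  assume f: "\<forall>x\<in>H. \<forall>y\<in>H. x \<le> y \<longrightarrow> f y \<le> f x"
  from assms(2) show "(\<forall>x\<in>H. \<forall>y\<in>H. x \<le> y \<longrightarrow> g (f x) \<le> g (f y)) \<or> (\<forall>x\<in>H. \<forall>y\<in>H. x \<le> y \<longrightarrow> g (f y) \<le> g (f x))"
    unfolding monotonic_on_def using f assms(3) by (meson image_subset_iff)
qed

lemma monotonic_on_between:
  assumes "monotonic_on {a..b} f" "a \<le> x" "x \<le> y" "y \<le> z" "z \<le> b"
  shows "min (f x) (f z) \<le> f y \<and> f y \<le> max (f x) (f z)"
proof -
  have "x \<in> {a..b}" "y \<in> {a..b}" "z \<in> {a..b}" using assms by auto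
  with assms show ?thesis unfolding monotonic_on_def by (meson max.coboundedI1 max.coboundedI2 min.coboundedI1 min.coboundedI2)
qed

definition monotonic_chain :: "(nat \<times> nat) set \<Rightarrow> bool" where
  "monotonic_chain X \<longleftrightarrow>
     (\<forall>p i p' i'. (p, i) \<in> X \<longrightarrow> (p', i') \<in> X \<longrightarrow> p \<le> p' \<longrightarrow> i \<le> i') \<or>
     (\<forall>p i p' i'. (p, i) \<in> X \<longrightarrow> (p', i') \<in> X \<longrightarrow> p \<le> p' \<longrightarrow> i' \<le> i)"

lemma monotonic_chain_functional:
  "monotonic_chain X \<Longrightarrow> (p, i) \<in> X \<Longrightarrow> (p, i') \<in> X \<Longrightarrow> i = i'"
  unfolding monotonic_chain_def by (meson le_refl order_antisym)

lemma monotonic_chain_pullback: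
  assumes "monotonic_chain X" "monotonic_on H f"
  shows "monotonic_chain {(p, i). p \<in> H \<and> (f p, i) \<in> X}"
  using assms(1)[unfolded monotonic_chain_def]
proof
  assume X: "\<forall>p i p' i'. (p, i) \<in> X \<longrightarrow> (p', i') \<in> X \<longrightarrow> p \<le> p' \<longrightarrow> i \<le> i'"
  then show ?thesis using assms(2) unfolding monotonic_on_def monotonic_chain_def by blast
next
  assume X: "\<forall>p i p' i'. (p, i) \<in> X \<longrightarrow> (p', i') \<in> X \<longrightarrow> p \<le> p' \<longrightarrow> i' \<le> i"
  then show ?thesis using assms(2) unfolding monotonic_on_def monotonic_chain_def by blast
qed

text \<open>Only covering is asked for: chains may contain pairs outside the relation, so constant
  chains and pullbacks need no trimming.\<close>

definition chain_cover :: "nat \<Rightarrow> (nat \<Rightarrow> nat set) \<Rightarrow> bool" where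
  "chain_cover K f \<longleftrightarrow> (\<exists>\<F>. finite \<F> \<and> card \<F> \<le> K \<and> (\<forall>X\<in>\<F>. monotonic_chain X) \<and>
     {(p, i). i \<in> f p} \<subseteq> \<Union>\<F>)"

lemma chain_cover_mono: "chain_cover K f \<Longrightarrow> K \<le> K' \<Longrightarrow> chain_cover K' f"
  unfolding chain_cover_def by (meson order_trans)

text \<open>Either alternative of \<open>monotonic_chain\<close>, applied to \<open>p = p'\<close>
  both ways round, leaves at most one block per cell in a chain.\<close>

lemma chain_cover_card:
  assumes "chain_cover K f"
  shows "finite (f p) \<and> card (f p) \<le> K"
proof -
  obtain \<F> where F: "finite \<F>" "card \<F> \<le> K" "\<And>X. X \<in> \<F> \<Longrightarrow> monotonic_chain X"
    "{(p, i). i \<in> f p} \<subseteq> \<Union>\<F>"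
    using assms unfolding chain_cover_def by blast
  define g where "g X = (THE i. (p, i) \<in> X)" for X :: "(nat \<times> nat) set"
  have "f p \<subseteq> g ` \<F>"
  proof
    fix i assume "i \<in> f p"
    then obtain X where X: "X \<in> \<F>" "(p, i) \<in> X" using F(4) by blast
    then have "g X = i" unfolding g_def
      using monotonic_chain_functional[OF F(3)] by blast
    with X(1) show "i \<in> g ` \<F>" by blast
  qed
  moreover have "finite (g ` \<F>)" "card (g ` \<F>) \<le> K"
    using F(1,2) card_image_le[of \<F> g] by auto
  ultimately show ?thesis by (meson card_mono finite_subset order_trans)
qed

section \<open>Evolution of tags under heads that move monotonically between turns\<close>

definition changes :: "(nat \<Rightarrow> 'b) \<Rightarrow> nat set" where
  "changes f = {p. f p \<noteq> f (Suc p)}"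

locale tagged_sweeps =
  fixes t :: nat and pos :: "nat \<Rightarrow> nat \<Rightarrow> nat" and turn :: "nat \<Rightarrow> bool"
    and tag0 :: "nat \<Rightarrow> nat \<Rightarrow> nat set"
  assumes unit_step: "pos (Suc k) j \<le> pos k j + 1 \<and> pos k j \<le> pos (Suc k) j + 1"
    and sweep: "j < t \<Longrightarrow> (\<And>k. k0 < k \<Longrightarrow> k < l \<Longrightarrow> \<not> turn k) \<Longrightarrow> monotonic_on {k0..l} (\<lambda>k. pos k j)"
begin

text \<open>The second component keeps the tag that the cell under a head had on arrival, because
  the tag itself is replaced at once. The cell left and the cell entered are both retagged, so the
  retagged cells of a sweep fill the closed interval between its end points. The new tag is the
  union of the current readings only: earlier readings act through the memory, and the trace records
  the memory whenever a reading changes.\<close>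

primrec tagging :: "nat \<Rightarrow> (nat \<Rightarrow> nat \<Rightarrow> nat set) \<times> (nat \<Rightarrow> nat set)" where
  "tagging 0 = (tag0, \<lambda>j. tag0 j (pos 0 j))"
| "tagging (Suc k) =
     (\<lambda>j p. if j < t \<and> (p = pos k j \<or> p = pos (Suc k) j) then \<Union>j<t. snd (tagging k) j
        else fst (tagging k) j p,
      \<lambda>j. if pos (Suc k) j = pos k j then snd (tagging k) j
        else fst (tagging k) j (pos (Suc k) j))"

definition tag :: "nat \<Rightarrow> nat \<Rightarrow> nat \<Rightarrow> nat set" where "tag k = fst (tagging k)"
definition reading :: "nat \<Rightarrow> nat \<Rightarrow> nat set" where "reading k = snd (tagging k)"
definition seen :: "nat \<Rightarrow> nat set" where "seen k = (\<Union>j<t. reading k j)"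

lemma tag_0 [simp]: "tag 0 = tag0" by (simp add: tag_def)
lemma reading_0 [simp]: "reading 0 j = tag0 j (pos 0 j)" by (simp add: reading_def)

lemma tag_Suc: "tag (Suc k) j p =
    (if j < t \<and> (p = pos k j \<or> p = pos (Suc k) j) then seen k else tag k j p)"
  by (auto simp: tag_def reading_def seen_def)

lemma reading_Suc: "reading (Suc k) j =
    (if pos (Suc k) j = pos k j then reading k j else tag k j (pos (Suc k) j))"
  by (simp add: tag_def reading_def)

text \<open>A turn at \<open>k0\<close> itself is allowed, since the step out of \<open>k0\<close>
  is the one that begins the sweep.\<close>

definition turn_free :: "nat \<Rightarrow> nat \<Rightarrow> bool" where
  "turn_free k0 l \<longleftrightarrow> k0 \<le> l \<and> (\<forall>k. k0 < k \<longrightarrow> k < l \<longrightarrow> \<not> turn k)"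

lemma turn_free_monotonic: "turn_free k0 l \<Longrightarrow> j < t \<Longrightarrow> monotonic_on {k0..l} (\<lambda>k. pos k j)"
  unfolding turn_free_def using sweep by blast

lemma turn_free_prefix: "turn_free k0 l \<Longrightarrow> k0 \<le> l' \<Longrightarrow> l' \<le> l \<Longrightarrow> turn_free k0 l'"
  unfolding turn_free_def by auto

definition reach :: "nat \<Rightarrow> nat \<Rightarrow> nat \<Rightarrow> nat set" where
  "reach k0 l j = {min (pos k0 j) (pos l j)..max (pos k0 j) (pos l j)}"

lemma pos_in_reach:
  assumes "turn_free k0 l" "j < t" "k0 \<le> k" "k \<le> l"
  shows "pos k j \<in> reach k0 l j"
  using monotonic_on_between[OF turn_free_monotonic[OF assms(1,2)], of k0 k l] assms(3,4)
  unfolding reach_def by auto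

lemma reach_Suc:
  assumes "turn_free k0 (Suc l)" "k0 \<le> l" "j < t"
  shows "reach k0 (Suc l) j = insert (pos (Suc l) j) (reach k0 l j)"
    and "pos (Suc l) j \<noteq> pos l j \<Longrightarrow> pos (Suc l) j \<notin> reach k0 l j"
proof -
  have m: "monotonic_on {k0..Suc l} (\<lambda>k. pos k j)" by (rule turn_free_monotonic[OF assms(1,3)])
  have mem: "k0 \<in> {k0..Suc l}" "l \<in> {k0..Suc l}" "Suc l \<in> {k0..Suc l}" using assms(2) by auto
  have "(pos k0 j \<le> pos l j \<and> pos l j \<le> pos (Suc l) j) \<or> (pos k0 j \<ge> pos l j \<and> pos l j \<ge> pos (Suc l) j)"
    using m mem assms(2) unfolding monotonic_on_def by (meson le_SucI order_refl)
  with unit_step[of l j]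
  show "reach k0 (Suc l) j = insert (pos (Suc l) j) (reach k0 l j)"
    "pos (Suc l) j \<noteq> pos l j \<Longrightarrow> pos (Suc l) j \<notin> reach k0 l j"
    unfolding reach_def by auto
qed

lemma tag_outside_reach:
  assumes "turn_free k0 l" "j < t" "p \<notin> reach k0 l j"
  shows "tag l j p = tag k0 j p"
proof -
  have "k0 \<le> l" using assms(1) by (simp add: turn_free_def)
  then show ?thesis using assms(1,3)
  proof (induction l rule: dec_induct)
    case (step l)
    have h: "reach k0 (Suc l) j = insert (pos (Suc l) j) (reach k0 l j)"
      using reach_Suc step assms(2) by blast
    have "turn_free k0 l" using step turn_free_prefix[of k0 "Suc l" l] by auto
    moreover from this have "pos l j \<in> reach k0 l j" using pos_in_reach assms(2) step by blast
    ultimately show ?case using step h by (auto simp: tag_Suc)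
  qed simp
qed

text \<open>A step that does not touch \<open>p\<close> keeps its tag, so the tag stems from the
  last step that entered or left \<open>p\<close>.\<close>

lemma tag_inside_reach:
  assumes "turn_free k0 l" "k0 < l" "j < t" "p \<in> reach k0 l j"
  shows "\<exists>k. k0 \<le> k \<and> k < l \<and> tag l j p = seen k \<and> (p = pos k j \<or> p = pos (Suc k) j)"
proof -
  have "Suc k0 \<le> l" using assms(2) by simp
  then show ?thesis using assms(1,4)
  proof (induction l rule: dec_induct)
    case base
    have "p = pos k0 j \<or> p = pos (Suc k0) j" using base unit_step[of k0 j] unfolding reach_def by auto
    then show ?case using assms(3) by (auto simp: tag_Suc)
  next
    case (step l)
    have h: "reach k0 (Suc l) j = insert (pos (Suc l) j) (reach k0 l j)"
      using reach_Suc step assms(3) Suc_leD by blast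
    have tf: "turn_free k0 l" using step turn_free_prefix[of k0 "Suc l" l] by auto
    show ?case
    proof (cases "p = pos l j \<or> p = pos (Suc l) j")
      case True
      then show ?thesis using assms(3) step(1) by (auto simp: tag_Suc intro!: exI[of _ l])
    next
      case False
      then have "p \<in> reach k0 l j" using step.prems h by auto
      from step.IH[OF tf this] False show ?thesis by (auto simp: tag_Suc)
    qed
  qed
qed

text \<open>A monotone head enters each new cell before the current sweep has retagged it, so it
  reads the tag from before the sweep. The start cell is the exception: its tag may already have
  been replaced, and the reading at \<open>k0\<close> must be carried along.\<close>

lemma reading_turn_free:
  assumes "turn_free k0 l" "j < t"
  shows "reading l j = (if pos l j = pos k0 j then reading k0 j else tag k0 j (pos l j))"
proof -
  have "k0 \<le> l" using assms(1) by (simp add: turn_free_def)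
  then show ?thesis using assms(1)
  proof (induction l rule: dec_induct)
    case (step l)
    have tf: "turn_free k0 l" using step turn_free_prefix[of k0 "Suc l" l] by auto
    show ?case
    proof (cases "pos (Suc l) j = pos l j")
      case True
      then show ?thesis using step.IH[OF tf] by (simp add: reading_Suc)
    next
      case False
      then have n: "pos (Suc l) j \<notin> reach k0 l j" using reach_Suc(2) step assms(2) by blast
      then have "pos (Suc l) j \<noteq> pos k0 j" unfolding reach_def by auto
      with False show ?thesis using tag_outside_reach[OF tf assms(2) n] by (simp add: reading_Suc)
    qed
  qed simp
qed

definition event :: "nat \<Rightarrow> bool" where
  "event k \<longleftrightarrow> k = 0 \<or> turn k \<or> (\<exists>j<t. reading k j \<noteq> reading (k - 1) j)"

lemma seen_constant:
  assumes "k \<le> l" "\<And>e. k < e \<Longrightarrow> e \<le> l \<Longrightarrow> \<not> event e"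
  shows "j < t \<Longrightarrow> reading l j = reading k j" "seen l = seen k"
proof -
  have r: "\<forall>j<t. reading l j = reading k j" using assms
  proof (induction l rule: dec_induct)
    case (step l)
    have "\<not> event (Suc l)" using step by auto
    then show ?case using step unfolding event_def by auto
  qed simp
  then show "j < t \<Longrightarrow> reading l j = reading k j" by simp
  from r show "seen l = seen k" unfolding seen_def by auto
qed

text \<open>The time \<open>\<tau> p\<close> of the step that gave \<open>p\<close> its tag is
  monotone in \<open>p\<close>, and so is the place of every head \<open>j'\<close> at that time.
  Chains of each stream therefore pull back along \<open>p \<mapsto> pos (\<tau> p) j'\<close>.
  Readings inherited from the start of the sweep become constant chains, at most \<open>K\<close>
  per stream. With the old chains of stream \<open>j\<close>, for the cells not visited, this makes
  \<open>K + t * K + t * K\<close>.\<close>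

lemma chain_cover_turn_free:
  assumes tf: "turn_free k0 l" and j: "j < t"
    and cov: "\<And>j. j < t \<Longrightarrow> chain_cover K (tag k0 j)"
    and rd: "\<And>j. j < t \<Longrightarrow> finite (reading k0 j) \<and> card (reading k0 j) \<le> K"
  shows "chain_cover ((2 * t + 1) * K) (tag l j)"
    and "finite (reading l j) \<and> card (reading l j) \<le> K"
proof -
  show "finite (reading l j) \<and> card (reading l j) \<le> K"
    using reading_turn_free[OF tf j] rd[OF j] chain_cover_card[OF cov[OF j]] by simp
  show "chain_cover ((2 * t + 1) * K) (tag l j)"
  proof (cases "k0 < l")
    case False
    then have "l = k0" using tf by (simp add: turn_free_def)
    then show ?thesis using cov[OF j] chain_cover_mono[of K "tag k0 j"] by simp
  next
    case True
    define Q where "Q j \<F> \<longleftrightarrow> finite \<F> \<and> card \<F> \<le> K \<and> (\<forall>X\<in>\<F>. monotonic_chain X) \<and>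
       {(p, i). i \<in> tag k0 j p} \<subseteq> \<Union>\<F>" for j \<F>
    define \<F> where "\<F> j = (SOME \<F>. Q j \<F>)" for j
    have "Q j (\<F> j)" if "j < t" for j
      unfolding \<F>_def by (rule someI_ex) (use cov[OF that] in \<open>simp add: chain_cover_def Q_def\<close>)
    then have F: "finite (\<F> j) \<and> card (\<F> j) \<le> K \<and> (\<forall>X\<in>\<F> j. monotonic_chain X) \<and>
       {(p, i). i \<in> tag k0 j p} \<subseteq> \<Union>(\<F> j)" if "j < t" for j using that unfolding Q_def by blast
    define H where "H = reach k0 l j"
    have "\<forall>p. \<exists>k. p \<in> H \<longrightarrow> k0 \<le> k \<and> k < l \<and> tag l j p = seen k \<and> (p = pos k j \<or> p = pos (Suc k) j)"
      using tag_inside_reach[OF tf True j] unfolding H_def by blast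
    then obtain \<tau> where \<tau>: "\<And>p. p \<in> H \<Longrightarrow> k0 \<le> \<tau> p \<and> \<tau> p < l \<and> tag l j p = seen (\<tau> p) \<and>
        (p = pos (\<tau> p) j \<or> p = pos (Suc (\<tau> p)) j)" by metis
    \<comment> \<open>Neighbouring cells may share a step, and \<open>\<tau> p\<close> is known only
      as a step that enters or leaves \<open>p\<close>. Still, a reversal of the order would squeeze
      both cells onto one position, hence \<open>p = q\<close>, a contradiction.\<close>
    have mono_\<tau>: "monotonic_on H \<tau>"
      using turn_free_monotonic[OF tf j] unfolding monotonic_on_def
    proof
      assume m: "\<forall>x\<in>{k0..l}. \<forall>y\<in>{k0..l}. x \<le> y \<longrightarrow> pos x j \<le> pos y j"
      have up: "pos x j \<le> pos y j" if "k0 \<le> x" "x \<le> y" "y \<le> l" for x y using m that by auto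
      have "\<tau> p \<le> \<tau> q" if "p \<in> H" "q \<in> H" "p \<le> q" for p q
      proof (rule ccontr)
        assume "\<not> \<tau> p \<le> \<tau> q"
        then have "Suc (\<tau> q) \<le> \<tau> p" by simp
        then have "pos (Suc (\<tau> q)) j \<le> pos (\<tau> p) j" using up[of "Suc (\<tau> q)" "\<tau> p"] \<tau>[OF that(1)] \<tau>[OF that(2)] by auto
        moreover have "pos (\<tau> p) j \<le> p"
          using up[of "\<tau> p" "Suc (\<tau> p)"] \<tau>[OF that(1)] by auto
        moreover have "q \<le> pos (Suc (\<tau> q)) j"
          using up[of "\<tau> q" "Suc (\<tau> q)"] \<tau>[OF that(2)] by auto
        ultimately have "p = q" using that by simp
        then show False using \<open>\<not> \<tau> p \<le> \<tau> q\<close> by simp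
      qed
      then show "(\<forall>x\<in>H. \<forall>y\<in>H. x \<le> y \<longrightarrow> \<tau> x \<le> \<tau> y) \<or> (\<forall>x\<in>H. \<forall>y\<in>H. x \<le> y \<longrightarrow> \<tau> y \<le> \<tau> x)" by blast
    next
      assume m: "\<forall>x\<in>{k0..l}. \<forall>y\<in>{k0..l}. x \<le> y \<longrightarrow> pos y j \<le> pos x j"
      have dn: "pos y j \<le> pos x j" if "k0 \<le> x" "x \<le> y" "y \<le> l" for x y using m that by auto
      have "\<tau> q \<le> \<tau> p" if "p \<in> H" "q \<in> H" "p \<le> q" for p q
      proof (rule ccontr)
        assume "\<not> \<tau> q \<le> \<tau> p"
        then have "Suc (\<tau> p) \<le> \<tau> q" by simp
        then have "pos (Suc (\<tau> p)) j \<ge> pos (\<tau> q) j" using dn[of "Suc (\<tau> p)" "\<tau> q"] \<tau>[OF that(1)] \<tau>[OF that(2)] by auto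
        moreover have "pos (Suc (\<tau> p)) j \<le> p"
          using dn[of "\<tau> p" "Suc (\<tau> p)"] \<tau>[OF that(1)] by auto
        moreover have "q \<le> pos (\<tau> q) j"
          using dn[of "\<tau> q" "Suc (\<tau> q)"] \<tau>[OF that(2)] by auto
        ultimately have "p = q" using that by simp
        then show False using \<open>\<not> \<tau> q \<le> \<tau> p\<close> by simp
      qed
      then show "(\<forall>x\<in>H. \<forall>y\<in>H. x \<le> y \<longrightarrow> \<tau> x \<le> \<tau> y) \<or> (\<forall>x\<in>H. \<forall>y\<in>H. x \<le> y \<longrightarrow> \<tau> y \<le> \<tau> x)" by blast
    qed
    have mono_pos: "monotonic_on H (\<lambda>p. pos (\<tau> p) j')" if "j' < t" for j'
      by (rule monotonic_on_compose[OF mono_\<tau> turn_free_monotonic[OF tf that]]) (use \<tau> in force)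
    define \<G> where "\<G> = (\<lambda>j'. (\<lambda>X. {(p, i). p \<in> H \<and> (pos (\<tau> p) j', i) \<in> X}) ` \<F> j')"
    define \<D> where "\<D> = (\<lambda>j'. (\<lambda>i. UNIV \<times> {i} :: (nat \<times> nat) set) ` reading k0 j')"
    define \<E> where "\<E> = \<F> j \<union> ((\<Union>j'<t. \<G> j') \<union> (\<Union>j'<t. \<D> j'))"
    have G: "finite (\<G> j') \<and> card (\<G> j') \<le> K" if "j' < t" for j'
      using F[OF that] unfolding \<G>_def by (meson card_image_le finite_imageI order_trans)
    have D: "finite (\<D> j') \<and> card (\<D> j') \<le> K" if "j' < t" for j'
      using rd[OF that] unfolding \<D>_def by (meson card_image_le finite_imageI order_trans)
    have "finite \<E>" using F[OF j] G D unfolding \<E>_def by auto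
    moreover have "card \<E> \<le> (2 * t + 1) * K"
    proof -
      have "card (\<Union>j'<t. \<G> j') \<le> (\<Sum>j'<t. card (\<G> j'))" by (rule card_UN_le) simp
      also have "\<dots> \<le> (\<Sum>j'<t. K)" by (rule sum_mono) (use G in auto)
      finally have g: "card (\<Union>j'<t. \<G> j') \<le> t * K" by simp
      have "card (\<Union>j'<t. \<D> j') \<le> (\<Sum>j'<t. card (\<D> j'))" by (rule card_UN_le) simp
      also have "\<dots> \<le> (\<Sum>j'<t. K)" by (rule sum_mono) (use D in auto)
      finally have d: "card (\<Union>j'<t. \<D> j') \<le> t * K" by simp
      have "card \<E> \<le> card (\<F> j) + (card (\<Union>j'<t. \<G> j') + card (\<Union>j'<t. \<D> j'))"
        unfolding \<E>_def by (meson card_Un_le add_left_mono order_trans)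
      also have "\<dots> \<le> K + (t * K + t * K)" using F[OF j] g d by (intro add_mono) auto
      finally show ?thesis by (simp add: algebra_simps)
    qed
    moreover have "monotonic_chain X" if X: "X \<in> \<E>" for X
    proof -
      have "monotonic_chain X" if "j' < t" "X \<in> \<G> j'" for j'
      proof -
        from that obtain Y where Y: "Y \<in> \<F> j'" "X = {(p, i). p \<in> H \<and> (pos (\<tau> p) j', i) \<in> Y}"
          unfolding \<G>_def by blast
        then show ?thesis using monotonic_chain_pullback[OF _ mono_pos[OF that(1)]] F[OF that(1)] by simp
      qed
      moreover have "monotonic_chain X" if "j' < t" "X \<in> \<D> j'" for j'
        using that unfolding \<D>_def monotonic_chain_def by auto
      ultimately show ?thesis using X F[OF j] unfolding \<E>_def by auto
    qed
    moreover have "{(p, i). i \<in> tag l j p} \<subseteq> \<Union>\<E>"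
    proof clarify
      fix p i assume i: "i \<in> tag l j p"
      show "(p, i) \<in> \<Union>\<E>"
      proof (cases "p \<in> H")
        case False
        then have "i \<in> tag k0 j p" using i tag_outside_reach[OF tf j] unfolding H_def by simp
        then show ?thesis using F[OF j] unfolding \<E>_def by auto
      next
        case True
        then have "i \<in> seen (\<tau> p)" using i \<tau> by simp
        then obtain j' where j': "j' < t" "i \<in> reading (\<tau> p) j'" unfolding seen_def by auto
        have tf': "turn_free k0 (\<tau> p)" using turn_free_prefix[OF tf] \<tau>[OF True] by auto
        from j' consider "i \<in> reading k0 j'" | "i \<in> tag k0 j' (pos (\<tau> p) j')"
          using reading_turn_free[OF tf' j'(1)] by (auto split: if_splits)
        then show ?thesis
        proof cases
          case 1
          then have "(p, i) \<in> \<Union>(\<D> j')" unfolding \<D>_def by auto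
          then show ?thesis using j' unfolding \<E>_def by auto
        next
          case 2
          then have "(pos (\<tau> p) j', i) \<in> \<Union>(\<F> j')" using F[OF j'(1)] by auto
          then have "(p, i) \<in> \<Union>(\<G> j')" using True unfolding \<G>_def by auto
          then show ?thesis using j' unfolding \<E>_def by auto
        qed
      qed
    qed
    ultimately show ?thesis unfolding chain_cover_def by blast
  qed
qed

section \<open>Number of events and of tag boundaries in a sweep\<close>

definition events :: "nat \<Rightarrow> nat \<Rightarrow> nat set" where
  "events k l = {e \<in> {k..<l}. event e}"

lemma finite_events [simp]: "finite (events k l)" by (simp add: events_def)

text \<open>A reading changes only when a head crosses a boundary between tags from before the
  sweep, and a monotone head crosses each boundary once. The reading of the start cell may differ
  from its tag, which costs the two edges of that cell on each stream; the last \<open>1\<close>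
  pays for \<open>k0\<close>.\<close>

lemma card_events_turn_free:
  assumes tf: "turn_free k0 l" and fin: "\<And>j. j < t \<Longrightarrow> finite (changes (tag k0 j))"
  shows "card (events k0 l) \<le> (\<Sum>j<t. card (changes (tag k0 j))) + 2 * t + 1"
proof -
  define X where "X j = {k. k0 < k \<and> k < l \<and> reading k j \<noteq> reading (k - 1) j}" for j
  have finX: "finite (X j)" for j unfolding X_def by auto
  have cX: "card (X j) \<le> card (changes (tag k0 j)) + 2" if j: "j < t" for j
  proof -
    \<comment> \<open>The edge crossed on arrival at time \<open>k\<close>, named by its left
      cell.\<close>
    define f where "f k = min (pos k j) (pos (k - 1) j)" for k
    have moved: "pos k j \<noteq> pos (k - 1) j" if "k \<in> X j" for k
      using that reading_Suc[of "k - 1" j] unfolding X_def by (auto split: if_splits)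
    have adj: "pos k j = pos (k - 1) j + 1 \<or> pos (k - 1) j = pos k j + 1" if "k \<in> X j" for k
    proof -
      have "k = Suc (k - 1)" using that unfolding X_def by auto
      then show ?thesis using unit_step[of "k - 1" j] moved[OF that] by auto
    qed
    have less: "f k \<noteq> f k'" if "k \<in> X j" "k' \<in> X j" "k < k'" for k k'
    proof -
      have r: "k0 \<le> k - 1" "k - 1 \<le> k" "k \<le> k' - 1" "k' - 1 \<le> k'" "k' \<le> l" "k - 1 \<le> k'"
        using that unfolding X_def by auto
      have "monotonic_on {k0..l} (\<lambda>k. pos k j)" by (rule turn_free_monotonic[OF tf j])
      then consider "pos (k - 1) j \<le> pos k j" "pos k j \<le> pos (k' - 1) j" "pos (k' - 1) j \<le> pos k' j"
        | "pos (k - 1) j \<ge> pos k j" "pos k j \<ge> pos (k' - 1) j" "pos (k' - 1) j \<ge> pos k' j"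
        unfolding monotonic_on_def using r by (smt (verit) atLeastAtMost_iff le_trans)
      then show ?thesis using moved[OF that(1)] moved[OF that(2)] unfolding f_def by cases auto
    qed
    then have inj: "inj_on f (X j)" by (metis inj_onI linorder_neqE_nat)
    have "f ` X j \<subseteq> changes (tag k0 j) \<union> {pos k0 j, pos k0 j - 1}"
    proof
      fix q assume "q \<in> f ` X j"
      then obtain k where k: "k \<in> X j" "q = f k" by blast
      have kk: "k = Suc (k - 1)" "k0 \<le> k - 1" "k - 1 \<le> l" "k \<le> l" "k0 \<le> k" using k unfolding X_def by auto
      show "q \<in> changes (tag k0 j) \<union> {pos k0 j, pos k0 j - 1}"
      proof (cases "pos (k - 1) j = pos k0 j")
        case True
        then show ?thesis using adj[OF k(1)] k(2) unfolding f_def by auto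
      next
        case False
        have "reading (k - 1) j = tag k0 j (pos (k - 1) j)"
          using reading_turn_free[OF turn_free_prefix[OF tf kk(2,3)] j] False by simp
        moreover have "pos k j \<noteq> pos k0 j"
        proof -
          have "pos k j \<notin> reach k0 (k - 1) j"
            using reach_Suc(2)[of k0 "k - 1" j] turn_free_prefix[OF tf kk(5,4)] kk moved[OF k(1)] j by simp
          then show ?thesis unfolding reach_def by auto
        qed
        then have "reading k j = tag k0 j (pos k j)"
          using reading_turn_free[OF turn_free_prefix[OF tf kk(5,4)] j] by simp
        ultimately have "tag k0 j (pos k j) \<noteq> tag k0 j (pos (k - 1) j)"
          using k(1) unfolding X_def by auto
        then show ?thesis using adj[OF k(1)] k(2) unfolding f_def changes_def by auto
      qed
    qed
    then have "card (f ` X j) \<le> card (changes (tag k0 j) \<union> {pos k0 j, pos k0 j - 1})"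
      using fin[OF j] by (intro card_mono) auto
    also have "\<dots> \<le> card (changes (tag k0 j)) + card {pos k0 j, pos k0 j - 1}" by (rule card_Un_le)
    also have "\<dots> \<le> card (changes (tag k0 j)) + 2" by (simp add: card_insert_le_m1)
    finally show ?thesis using card_image[OF inj] by simp
  qed
  have "events k0 l \<subseteq> {k0} \<union> (\<Union>j<t. X j)"
  proof
    fix e assume e: "e \<in> events k0 l"
    show "e \<in> {k0} \<union> (\<Union>j<t. X j)"
    proof (cases "e = k0")
      case False
      then have "k0 < e" "e < l" "event e" using e by (auto simp: events_def)
      then have "\<exists>j<t. reading e j \<noteq> reading (e - 1) j" using tf by (auto simp: event_def turn_free_def)
      then show ?thesis using \<open>k0 < e\<close> \<open>e < l\<close> unfolding X_def by blast
    qed simp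
  qed
  then have "card (events k0 l) \<le> card ({k0} \<union> (\<Union>j<t. X j))" using finX by (intro card_mono) auto
  also have "\<dots> \<le> 1 + card (\<Union>j<t. X j)" using card_Un_le[of "{k0}" "\<Union>j<t. X j"] by simp
  also have "card (\<Union>j<t. X j) \<le> (\<Sum>j<t. card (X j))" by (rule card_UN_le) simp
  also have "\<dots> \<le> (\<Sum>j<t. card (changes (tag k0 j)) + 2)" by (rule sum_mono) (use cX in auto)
  also have "\<dots> = (\<Sum>j<t. card (changes (tag k0 j))) + 2 * t" by (subst sum.distrib) simp
  finally show ?thesis by simp
qed

lemma exists_event_between:
  assumes "k < l" "seen k \<noteq> seen l"
  shows "\<exists>e. k < e \<and> e \<le> l \<and> event e"
  using seen_constant(2)[of k l] assms by force

text \<open>A boundary inside the swept interval separates two values of \<open>seen\<close>, so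
  some event happens while the head is on one of the two cells; each event pays for both edges of
  the cell under the head. The ends of the interval cost at most 4.\<close>

lemma changes_turn_free:
  assumes tf: "turn_free k0 l" and j: "j < t" and fin: "finite (changes (tag k0 j))"
  shows "finite (changes (tag l j))"
    and "card (changes (tag l j)) \<le> card (changes (tag k0 j)) + 4 + 2 * card (events k0 l)"
proof -
  define B where "B = {pos k0 j, pos k0 j - 1, pos l j, pos l j - 1}"
  define V where "V = (\<lambda>e. pos e j) ` events k0 l \<union> (\<lambda>e. pos e j - 1) ` events k0 l"
  have sub: "changes (tag l j) \<subseteq> changes (tag k0 j) \<union> B \<union> V"
  proof
    fix p assume "p \<in> changes (tag l j)"
    then have ne: "tag l j p \<noteq> tag l j (Suc p)" by (simp add: changes_def)
    consider "p \<notin> reach k0 l j" "Suc p \<notin> reach k0 l j" | "p \<in> reach k0 l j" "Suc p \<in> reach k0 l j"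
      | "p \<in> reach k0 l j \<longleftrightarrow> Suc p \<notin> reach k0 l j" by blast
    then show "p \<in> changes (tag k0 j) \<union> B \<union> V"
    proof cases
      case 1
      then show ?thesis using ne tag_outside_reach[OF tf j] by (simp add: changes_def)
    next
      case 3
      then have "p \<in> B" unfolding reach_def B_def by (auto simp: min_def max_def split: if_splits)
      then show ?thesis by simp
    next
      case 2
      have "k0 < l"
      proof (rule ccontr)
        assume "\<not> k0 < l"
        then have "l = k0" using tf by (simp add: turn_free_def)
        then show False using 2 unfolding reach_def by auto
      qed
      obtain k where k: "k0 \<le> k" "k < l" "tag l j p = seen k" "p = pos k j \<or> p = pos (Suc k) j"
        using tag_inside_reach[OF tf \<open>k0 < l\<close> j 2(1)] by blast
      obtain k' where k': "k0 \<le> k'" "k' < l" "tag l j (Suc p) = seen k'"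
          "Suc p = pos k' j \<or> Suc p = pos (Suc k') j"
        using tag_inside_reach[OF tf \<open>k0 < l\<close> j 2(2)] by blast
      have "seen k \<noteq> seen k'" using ne k k' by simp
      have "\<exists>e. k0 < e \<and> e < l \<and> event e \<and> p \<le> pos e j \<and> pos e j \<le> Suc p"
        using turn_free_monotonic[OF tf j] unfolding monotonic_on_def
      proof
        assume m: "\<forall>x\<in>{k0..l}. \<forall>y\<in>{k0..l}. x \<le> y \<longrightarrow> pos x j \<le> pos y j"
        have up: "pos x j \<le> pos y j" if "k0 \<le> x" "x \<le> y" "y \<le> l" for x y using m that by auto
        have "k < k'"
        proof (rule ccontr)
          assume "\<not> k < k'"
          then have "Suc k' \<le> k" using \<open>seen k \<noteq> seen k'\<close> by (cases "k = k'") auto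
          then have "pos (Suc k') j \<le> pos k j" using up k' k by auto
          moreover have "pos k j \<le> pos (Suc k) j" "pos k' j \<le> pos (Suc k') j" using up k' k by auto
          ultimately show False using k(4) k'(4) by auto
        qed
        then obtain e where e: "k < e" "e \<le> k'" "event e"
          using exists_event_between[of k k'] \<open>seen k \<noteq> seen k'\<close> by blast
        then have "pos (Suc k) j \<le> pos e j" "pos e j \<le> pos k' j" "pos k j \<le> pos (Suc k) j"
           "pos k' j \<le> pos (Suc k') j" using up k' k by auto
        then have "p \<le> pos e j" "pos e j \<le> Suc p" using k(4) k'(4) by auto
        then show ?thesis using e k k' by (intro exI[of _ e]) auto
      next
        assume m: "\<forall>x\<in>{k0..l}. \<forall>y\<in>{k0..l}. x \<le> y \<longrightarrow> pos y j \<le> pos x j"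
        have dn: "pos y j \<le> pos x j" if "k0 \<le> x" "x \<le> y" "y \<le> l" for x y using m that by auto
        have "k' < k"
        proof (rule ccontr)
          assume "\<not> k' < k"
          then have "Suc k \<le> k'" using \<open>seen k \<noteq> seen k'\<close> by (cases "k = k'") auto
          then have "pos k' j \<le> pos (Suc k) j" using dn k' k by auto
          moreover have "pos (Suc k) j \<le> pos k j" "pos (Suc k') j \<le> pos k' j" using dn k' k by auto
          ultimately show False using k(4) k'(4) by auto
        qed
        then obtain e where e: "k' < e" "e \<le> k" "event e"
          using exists_event_between[of k' k] \<open>seen k \<noteq> seen k'\<close> by auto
        then have "pos e j \<le> pos (Suc k') j" "pos k j \<le> pos e j" "pos (Suc k) j \<le> pos k j"
           "pos (Suc k') j \<le> pos k' j" using dn k' k by auto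
        then have "p \<le> pos e j" "pos e j \<le> Suc p" using k(4) k'(4) by auto
        then show ?thesis using e k k' by (intro exI[of _ e]) auto
      qed
      then obtain e where "k0 < e" "e < l" "event e" "p \<le> pos e j" "pos e j \<le> Suc p" by blast
      then have "e \<in> events k0 l" "p = pos e j \<or> p = pos e j - 1"
        unfolding events_def by auto
      then have "p \<in> V" unfolding V_def by auto
      then show ?thesis by simp
    qed
  qed
  have finV: "finite (changes (tag k0 j) \<union> B \<union> V)" using fin unfolding B_def V_def by auto
  then show "finite (changes (tag l j))" using sub finite_subset by blast
  have "card B \<le> 4" unfolding B_def by (simp add: card_insert_le_m1)
  moreover have "card V \<le> 2 * card (events k0 l)"
    unfolding V_def using card_Un_le card_image_le[OF finite_events]
    by (smt (verit) add_mono mult_2 order_trans)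
  moreover have "card (changes (tag l j)) \<le> card (changes (tag k0 j) \<union> B \<union> V)"
    using finV sub by (intro card_mono)
  moreover have "card (changes (tag k0 j) \<union> B \<union> V) \<le> card (changes (tag k0 j)) + card B + card V"
    by (meson card_Un_le add_right_mono order_trans)
  ultimately show "card (changes (tag l j)) \<le> card (changes (tag k0 j)) + 4 + 2 * card (events k0 l)"
    by linarith
qed

text \<open>A potential: events so far plus boundaries that later sweeps can turn into events. The
  summand \<open>2 * t + 3\<close> absorbs the additive costs of a sweep, which leaves a purely
  multiplicative recursion.\<close>

definition complexity :: "nat \<Rightarrow> nat" where
  "complexity l = card (events 0 l) + (\<Sum>j<t. card (changes (tag l j))) + 2 * t + 3"

lemma complexity_turn_free:
  assumes tf: "turn_free k0 l" and fin: "\<And>j. j < t \<Longrightarrow> finite (changes (tag k0 j))"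
  shows "complexity l \<le> (2 * t + 2) * complexity k0"
proof -
  define c where "c = (\<Sum>j<t. card (changes (tag k0 j)))"
  have "(\<Sum>j<t. card (changes (tag l j))) \<le> (\<Sum>j<t. card (changes (tag k0 j)) + 4 + 2 * card (events k0 l))"
    by (rule sum_mono) (use changes_turn_free(2)[OF tf _ fin] in auto)
  also have "\<dots> = c + t * (4 + 2 * card (events k0 l))" by (simp add: sum.distrib c_def algebra_simps)
  finally have 1: "(\<Sum>j<t. card (changes (tag l j))) \<le> c + t * (4 + 2 * card (events k0 l))" .
  have 2: "card (events k0 l) \<le> c + 2 * t + 1" using card_events_turn_free[OF tf fin] by (simp add: c_def)
  have "events 0 l = events 0 k0 \<union> events k0 l" using tf unfolding events_def turn_free_def by auto
  then have 3: "card (events 0 l) \<le> card (events 0 k0) + card (events k0 l)" by (simp add: card_Un_le)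
  have "t * (4 + 2 * card (events k0 l)) \<le> t * (4 + 2 * (c + 2 * t + 1))"
    using 2 by (intro mult_left_mono) auto
  with 1 2 3 have "complexity l \<le> card (events 0 k0) + (c + 2 * t + 1) + (c + t * (4 + 2 * (c + 2 * t + 1))) + 2 * t + 3"
    unfolding complexity_def by linarith
  also have "\<dots> \<le> (2 * t + 2) * (card (events 0 k0) + c + 2 * t + 3)" by (simp add: algebra_simps)
  finally show ?thesis unfolding complexity_def c_def .
qed

definition turns :: "nat \<Rightarrow> nat" where "turns l = card {k. k < l \<and> turn k}"

text \<open>Induction along the last turn before \<open>l\<close>, with a factor
  \<open>2 * t + 2\<close> for each sweep; the additional factor is for the stretch before the first
  turn.\<close>

lemma tag_structure:
  assumes cov0: "\<And>j. j < t \<Longrightarrow> chain_cover 1 (tag0 j)"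
    and fin0: "\<And>j. j < t \<Longrightarrow> finite (changes (tag0 j))"
  shows "(\<forall>j<t. finite (changes (tag l j)) \<and> chain_cover ((2 * t + 2) ^ (turns l + 1)) (tag l j) \<and>
      finite (reading l j) \<and> card (reading l j) \<le> (2 * t + 2) ^ (turns l + 1)) \<and>
    complexity l \<le> (2 * t + 2) ^ (turns l + 1) * complexity 0"
proof -
  define b where "b = 2 * t + 2"
  define P where "P K l \<longleftrightarrow> (\<forall>j<t. finite (changes (tag l j)) \<and> chain_cover K (tag l j) \<and>
      finite (reading l j) \<and> card (reading l j) \<le> K) \<and> complexity l \<le> K * complexity 0" for K l
  have step: "P (b * K) l" if tf: "turn_free k0 l" and P: "P K k0" for K k0 l
  proof -
    have "chain_cover (b * K) (tag l j)" "finite (reading l j) \<and> card (reading l j) \<le> b * K"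
        "finite (changes (tag l j))" if "j < t" for j
    proof -
      have "(2 * t + 1) * K \<le> b * K" "K \<le> b * K" by (auto simp: b_def)
      then show "chain_cover (b * K) (tag l j)" "finite (reading l j) \<and> card (reading l j) \<le> b * K"
        using chain_cover_turn_free[OF tf that, of K] P chain_cover_mono unfolding P_def
        by (blast, meson order_trans)
      show "finite (changes (tag l j))" using changes_turn_free(1)[OF tf that] P that unfolding P_def by blast
    qed
    moreover have "complexity l \<le> b * K * complexity 0"
    proof -
      have "complexity l \<le> b * complexity k0" using complexity_turn_free[OF tf] P unfolding P_def b_def by blast
      also have "\<dots> \<le> b * (K * complexity 0)" using P unfolding P_def by (intro mult_left_mono) auto
      finally show ?thesis by (simp add: mult.assoc)
    qed
    ultimately show ?thesis unfolding P_def by blast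
  qed
  have P0: "P 1 0" using cov0 fin0 chain_cover_card[OF cov0] unfolding P_def by auto
  have "P (b ^ (turns l + 1)) l"
  proof (induction l rule: less_induct)
    case (less l)
    show ?case
    proof (cases "\<exists>k<l. turn k")
      case False
      then have "turn_free 0 l" "turns l = 0" by (auto simp: turn_free_def turns_def)
      then show ?thesis using step[OF _ P0, of l] by simp
    next
      case True
      define k0 where "k0 = Max {k. k < l \<and> turn k}"
      have fin: "finite {k. k < l \<and> turn k}" by simp
      have k0: "k0 < l" "turn k0" using Max_in[OF fin] True unfolding k0_def by auto
      have tf: "turn_free k0 l" unfolding turn_free_def
      proof (intro conjI allI impI notI)
        fix k assume "k0 < k" "k < l" "turn k"
        then have "k \<le> k0" unfolding k0_def by (intro Max_ge[OF fin]) simp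
        then show False using \<open>k0 < k\<close> by simp
      qed (use k0 in simp)
      have "{k. k < l \<and> turn k} = insert k0 {k. k < k0 \<and> turn k}"
        using k0 tf unfolding turn_free_def by (auto dest: linorder_neqE_nat)
      then have "turns l = Suc (turns k0)" unfolding turns_def by simp
      then show ?thesis using step[OF tf less[OF k0(1)]] by simp
    qed
  qed
  then show ?thesis unfolding P_def b_def .
qed

end

subsection \<open>Runs of a read/write algorithm\<close>

definition total_passes :: "('a, 'g) rw_algorithm \<Rightarrow> ('a, 'g) rw_config \<Rightarrow> nat" where
  "total_passes A C = (\<Sum>j<num_streams A. num_passes C j)"

definition turn_at :: "('a, 'g) rw_algorithm \<Rightarrow> 'a list \<Rightarrow> nat \<Rightarrow> bool" where
  "turn_at A s k \<longleftrightarrow> total_passes A (config_after A s (Suc k)) \<noteq> total_passes A (config_after A s k)"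

definition local_view :: "('a, 'g) rw_algorithm \<Rightarrow> ('a, 'g) rw_config \<Rightarrow> bool list \<times> ('a, 'g) cell list" where
  "local_view A C = (memory C, map (\<lambda>j. stream C j (position C j)) [0..<num_streams A])"

lemma transition_at_local_view:
  "transition_at A C = transition A (fst (local_view A C)) (snd (local_view A C))"
  by (simp add: transition_at_def local_view_def)

lemma local_view_eqI:
  assumes "memory C = memory C'"
    "\<And>j. j < num_streams A \<Longrightarrow> stream C j (position C j) = stream C' j (position C' j)"
  shows "local_view A C = local_view A C'"
  using assms by (auto simp: local_view_def)

lemma local_view_eqD:
  assumes "local_view A C = local_view A C'"
  shows "memory C = memory C'"
    "j < num_streams A \<Longrightarrow> stream C j (position C j) = stream C' j (position C' j)"
  using assms by (auto simp: local_view_def)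

lemma config_after_0 [simp]: "config_after A s 0 = initial_config A s"
  by (simp add: config_after_def)

lemma config_after_Suc: "config_after A s (Suc k) = next_config A (config_after A s k)"
  by (simp add: config_after_def)

lemma next_config_halted: "halted A C \<Longrightarrow> next_config A C = C"
  by (simp add: next_config_def halted_def)

lemma next_config_running:
  assumes "transition_at A C = Some (q, act)"
  shows "memory (next_config A C) = q"
    "stream (next_config A C) j = (if j < num_streams A
       then (stream C j)(position C j := fst (act j)) else stream C j)"
    "position (next_config A C) j = (if j < num_streams A
       then move_head (snd (act j)) (position C j) else position C j)"
    "heading (next_config A C) j = (if j < num_streams A \<and> starts_pass (heading C j) (snd (act j))
       then snd (act j) else heading C j)"
    "num_passes (next_config A C) j = (if j < num_streams A \<and> starts_pass (heading C j) (snd (act j))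
       then num_passes C j + 1 else num_passes C j)"
  using assms by (simp_all add: next_config_def)

lemma config_after_halted:
  assumes "halted A (config_after A s k)" "k \<le> l"
  shows "config_after A s l = config_after A s k"
  using assms(2)
proof (induction l rule: dec_induct)
  case (step l)
  then show ?case using assms(1) by (simp add: config_after_Suc next_config_halted)
qed simp

lemma running_cases:
  obtains "halted A C" | q act where "transition_at A C = Some (q, act)"
  by (cases "transition_at A C") (auto simp: halted_def)

lemma num_passes_mono: "num_passes C j \<le> num_passes (next_config A C) j"
  by (cases A C rule: running_cases) (simp_all add: next_config_halted next_config_running)

lemma total_passes_eq_imp:
  assumes "total_passes A (next_config A C) = total_passes A C" "j < num_streams A"
  shows "num_passes (next_config A C) j = num_passes C j"
proof (rule ccontr)
  assume "num_passes (next_config A C) j \<noteq> num_passes C j"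
  then have "num_passes C j < num_passes (next_config A C) j"
    using num_passes_mono[of C j A] by simp
  then have "total_passes A C < total_passes A (next_config A C)"
    unfolding total_passes_def using assms(2)
    by (intro sum_strict_mono_ex1) (auto intro: num_passes_mono)
  then show False using assms(1) by simp
qed

lemma not_turn_at_iff:
  assumes "transition_at A (config_after A s k) = Some (q, act)"
  shows "\<not> turn_at A s k \<longleftrightarrow>
    (\<forall>j<num_streams A. \<not> starts_pass (heading (config_after A s k) j) (snd (act j)))"
proof
  assume "\<not> turn_at A s k"
  then show "\<forall>j<num_streams A. \<not> starts_pass (heading (config_after A s k) j) (snd (act j))"
    using total_passes_eq_imp[of A "config_after A s k"] assms
    by (force simp: turn_at_def config_after_Suc next_config_running)
next
  assume "\<forall>j<num_streams A. \<not> starts_pass (heading (config_after A s k) j) (snd (act j))"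
  then show "\<not> turn_at A s k"
    using assms by (auto simp: turn_at_def config_after_Suc total_passes_def next_config_running)
qed

lemma turns_le_total_passes:
  "card {k. k < l \<and> turn_at A s k} \<le> total_passes A (config_after A s l)"
proof (induction l)
  case (Suc l)
  have le: "total_passes A (config_after A s l) \<le> total_passes A (config_after A s (Suc l))"
    unfolding total_passes_def by (rule sum_mono) (simp add: config_after_Suc num_passes_mono)
  show ?case
  proof (cases "turn_at A s l")
    case True
    then have "{k. k < Suc l \<and> turn_at A s k} = insert l {k. k < l \<and> turn_at A s k}"
      by (auto simp: less_Suc_eq)
    then show ?thesis using Suc le True by (simp add: turn_at_def)
  next
    case False
    then have "{k. k < Suc l \<and> turn_at A s k} = {k. k < l \<and> turn_at A s k}"
      by (auto simp: less_Suc_eq)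
    then show ?thesis using Suc le by simp
  qed
qed simp

lemma heading_not_turn:
  assumes "\<not> turn_at A s k" "j < num_streams A"
  shows "heading (config_after A s (Suc k)) j = heading (config_after A s k) j"
  using assms not_turn_at_iff[of A s k]
  by (cases A "config_after A s k" rule: running_cases)
    (auto simp: config_after_Suc next_config_halted next_config_running)

lemma heading_of_move:
  assumes "j < num_streams A"
  shows "position C j < position (next_config A C) j \<Longrightarrow> heading (next_config A C) j = Right"
    "position (next_config A C) j < position C j \<Longrightarrow> heading (next_config A C) j = Left"
proof -
  show "position C j < position (next_config A C) j \<Longrightarrow> heading (next_config A C) j = Right"
  proof (cases A C rule: running_cases)
    case (2 q act)
    assume "position C j < position (next_config A C) j"
    then have "snd (act j) = Right" using assms 2 by (cases "snd (act j)") (auto simp: next_config_running)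
    then show ?thesis using assms 2 by (auto simp: next_config_running starts_pass_def)
  qed (simp add: next_config_halted)
  show "position (next_config A C) j < position C j \<Longrightarrow> heading (next_config A C) j = Left"
  proof (cases A C rule: running_cases)
    case (2 q act)
    assume "position (next_config A C) j < position C j"
    then have "snd (act j) = Left" using assms 2 by (cases "snd (act j)") (auto simp: next_config_running)
    then show ?thesis using assms 2 by (auto simp: next_config_running starts_pass_def)
  qed (simp add: next_config_halted)
qed

lemma position_mono:
  assumes "j < num_streams A" "k \<le> l" "\<And>i. k \<le> i \<Longrightarrow> i < l \<Longrightarrow> \<not> turn_at A s i"
  shows "heading (config_after A s l) j = heading (config_after A s k) j"
    and "heading (config_after A s k) j = Right \<Longrightarrow>
      position (config_after A s k) j \<le> position (config_after A s l) j"
    and "heading (config_after A s k) j \<noteq> Right \<Longrightarrow>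
      position (config_after A s l) j \<le> position (config_after A s k) j"
proof -
  have "heading (config_after A s l) j = heading (config_after A s k) j \<and>
    (heading (config_after A s k) j = Right \<longrightarrow>
      position (config_after A s k) j \<le> position (config_after A s l) j) \<and>
    (heading (config_after A s k) j \<noteq> Right \<longrightarrow>
      position (config_after A s l) j \<le> position (config_after A s k) j)"
    using assms(2,3)
  proof (induction l rule: dec_induct)
    case (step l)
    then have h: "heading (config_after A s (Suc l)) j = heading (config_after A s l) j"
      using heading_not_turn[OF _ assms(1)] by simp
    show ?case using h step heading_of_move[OF assms(1), of "config_after A s l"]
      by (fastforce simp: config_after_Suc not_less[symmetric])
  qed simp
  then show "heading (config_after A s l) j = heading (config_after A s k) j"
     "heading (config_after A s k) j = Right \<Longrightarrow>
      position (config_after A s k) j \<le> position (config_after A s l) j"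
    "heading (config_after A s k) j \<noteq> Right \<Longrightarrow>
      position (config_after A s l) j \<le> position (config_after A s k) j" by auto
qed

lemma tagged_sweeps_run:
  "tagged_sweeps (num_streams A) (\<lambda>k. position (config_after A s k)) (turn_at A s)"
proof
  fix k j
  show "position (config_after A s (Suc k)) j \<le> position (config_after A s k) j + 1 \<and>
      position (config_after A s k) j \<le> position (config_after A s (Suc k)) j + 1"
  proof (cases A "config_after A s k" rule: running_cases)
    case (2 q act)
    then show ?thesis by (cases "snd (act j)") (auto simp: config_after_Suc next_config_running)
  qed (simp add: config_after_Suc next_config_halted)
next
  fix j k0 l
  assume j: "j < num_streams A" and nt: "\<And>k. k0 < k \<Longrightarrow> k < l \<Longrightarrow> \<not> turn_at A s k"
  let ?p = "\<lambda>k. position (config_after A s k) j" and ?h = "\<lambda>k. heading (config_after A s k) j"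
  \<comment> \<open>The step out of \<open>k0\<close> may begin a pass, so the direction is read off
    at \<open>Suc k0\<close>; \<open>max x (Suc k0)\<close> lets the argument for later times also
    cover \<open>x = k0\<close>. A head whose heading is still \<open>Stay\<close> has not moved and
    counts as non-increasing.\<close>
  have *: "?h (Suc k0) = Right \<and> ?p x \<le> ?p y \<or> ?h (Suc k0) \<noteq> Right \<and> ?p y \<le> ?p x"
    if "k0 \<le> x" "x < y" "y \<le> l" for x y
  proof -
    have first: "?h (Suc k0) = Right \<and> ?p k0 \<le> ?p (Suc k0) \<or> ?h (Suc k0) \<noteq> Right \<and> ?p (Suc k0) \<le> ?p k0"
      using heading_of_move[OF j, of "config_after A s k0"] by (auto simp: config_after_Suc not_less[symmetric])
    have "?h (max x (Suc k0)) = ?h (Suc k0)"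
      using position_mono(1)[OF j, of "Suc k0" "max x (Suc k0)" s] nt that by auto
    then have "?h (Suc k0) = Right \<and> ?p (max x (Suc k0)) \<le> ?p y \<or> ?h (Suc k0) \<noteq> Right \<and> ?p y \<le> ?p (max x (Suc k0))"
      using position_mono(2,3)[OF j, of "max x (Suc k0)" y s] nt that by auto
    then show ?thesis
    proof (cases "x = k0")
      case True
      then show ?thesis using first \<open>?h (Suc k0) = Right \<and> ?p (max x (Suc k0)) \<le> ?p y \<or> _\<close> by auto
    next
      case False
      then have "max x (Suc k0) = x" using that by simp
      then show ?thesis using \<open>?h (Suc k0) = Right \<and> ?p (max x (Suc k0)) \<le> ?p y \<or> _\<close> by simp
    qed
  qed
  show "monotonic_on {k0..l} ?p" unfolding monotonic_on_def
    by (cases "?h (Suc k0) = Right") (use * in \<open>auto simp: le_less\<close>)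
qed

subsection \<open>Running time\<close>

lemma position_le_time: "position (config_after A s k) j \<le> k"
proof (induction k)
  case (Suc k)
  have "position (config_after A s (Suc k)) j \<le> position (config_after A s k) j + 1"
    using tagged_sweeps.unit_step[OF tagged_sweeps_run] by blast
  then show ?case using Suc by simp
qed (simp add: initial_config_def)

lemma blank_beyond: "length s + k \<le> p \<Longrightarrow> stream (config_after A s k) j p = Blank"
proof (induction k)
  case (Suc k)
  have "p \<noteq> position (config_after A s k) j" using Suc.prems position_le_time[of A s k j] by auto
  then show ?case using Suc
    by (cases A "config_after A s k" rule: running_cases)
      (auto simp: config_after_Suc next_config_halted next_config_running)
qed (auto simp: initial_config_def stream_of_def)

text \<open>A step is quiet if every head stays within the cell it scans or is in blank territory beyond
  \<open>W\<close>; such steps see nothing new.\<close>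

definition quiet :: "('a, 'g) rw_algorithm \<Rightarrow> nat \<Rightarrow> ('a, 'g) rw_config \<Rightarrow> bool" where
  "quiet A W C \<longleftrightarrow> (\<exists>q act. transition_at A C = Some (q, act) \<and> (\<forall>j<num_streams A.
     snd (act j) = Stay \<or> snd (act j) = Left \<and> position C j = 0 \<or> snd (act j) = Right \<and> W \<le> position C j))"

text \<open>The clause on \<open>Left\<close> makes the property invariant between turns: a head
  that came back from beyond \<open>W\<close> would leave cells it has written on its right.\<close>

definition blank_ahead :: "('a, 'g) rw_algorithm \<Rightarrow> nat \<Rightarrow> ('a, 'g) rw_config \<Rightarrow> bool" where
  "blank_ahead A W C \<longleftrightarrow> (\<forall>j<num_streams A. (heading C j = Left \<longrightarrow> position C j < W) \<and>
     (\<forall>p. W \<le> p \<longrightarrow> position C j < p \<longrightarrow> stream C j p = Blank))"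

lemma blank_ahead_Suc:
  assumes "blank_ahead A W (config_after A s k)" "\<not> turn_at A s k"
  shows "blank_ahead A W (config_after A s (Suc k))"
proof (cases A "config_after A s k" rule: running_cases)
  case (2 q act)
  have "(heading (config_after A s (Suc k)) j = Left \<longrightarrow> position (config_after A s (Suc k)) j < W) \<and>
     (\<forall>p. W \<le> p \<longrightarrow> position (config_after A s (Suc k)) j < p \<longrightarrow> stream (config_after A s (Suc k)) j p = Blank)"
    if j: "j < num_streams A" for j
  proof -
    have "\<not> starts_pass (heading (config_after A s k) j) (snd (act j))"
      using not_turn_at_iff[OF 2] assms(2) j by blast
    then have "snd (act j) = Stay \<or> snd (act j) = heading (config_after A s k) j"
      by (auto simp: starts_pass_def)
    moreover have "heading (config_after A s (Suc k)) j = heading (config_after A s k) j"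
      using heading_not_turn[OF assms(2) j] .
    ultimately show ?thesis using assms(1) 2 j unfolding blank_ahead_def
      by (cases "snd (act j)") (auto simp: config_after_Suc next_config_running)
  qed
  then show ?thesis unfolding blank_ahead_def by blast
qed (use assms in \<open>simp add: config_after_Suc next_config_halted\<close>)

lemma blank_ahead_initially: "blank_ahead A (Suc (length s + k)) (config_after A s k)"
  unfolding blank_ahead_def using position_le_time[of A s k] blank_beyond[of s k _ A]
  by (auto simp: less_Suc_eq_le trans_le_add2)

text \<open>After a quiet step a head scans either the symbol it has just written or a blank beyond
  \<open>W\<close>, so the next view is a function of the present one, whatever the positions are. A
  left move at cell 0 stays there because subtraction is truncated.\<close>

lemma local_view_quiet:
  assumes "quiet A W C" "quiet A W C'" "blank_ahead A W C" "blank_ahead A W C'"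
    and "local_view A C = local_view A C'"
  shows "local_view A (next_config A C) = local_view A (next_config A C')"
proof -
  obtain q act where 1: "transition_at A C = Some (q, act)" and
    q1: "\<forall>j<num_streams A. snd (act j) = Stay \<or> snd (act j) = Left \<and> position C j = 0 \<or> snd (act j) = Right \<and> W \<le> position C j"
    using assms(1) unfolding quiet_def by blast
  have 2: "transition_at A C' = Some (q, act)"
    using 1 assms(5) by (simp add: transition_at_local_view)
  have q2: "\<forall>j<num_streams A. snd (act j) = Stay \<or> snd (act j) = Left \<and> position C' j = 0 \<or> snd (act j) = Right \<and> W \<le> position C' j"
    using assms(2) 2 unfolding quiet_def by auto
  show ?thesis
  proof (rule local_view_eqI)
    fix j assume j: "j < num_streams A"
    show "stream (next_config A C) j (position (next_config A C) j) =
       stream (next_config A C') j (position (next_config A C') j)"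
    proof (cases "snd (act j)")
      case Right
      then have "W \<le> position C j" "W \<le> position C' j" using q1 q2 j by auto
      then have "stream C j (Suc (position C j)) = Blank" "stream C' j (Suc (position C' j)) = Blank"
        using assms(3,4) j unfolding blank_ahead_def by (meson le_SucI lessI)+
      then show ?thesis using j Right by (simp add: next_config_running[OF 1] next_config_running[OF 2])
    qed (use j q1 q2 in \<open>auto simp: next_config_running[OF 1] next_config_running[OF 2]\<close>)
  qed (simp add: next_config_running[OF 1] next_config_running[OF 2])
qed

text \<open>Equal views give equal actions. The positions may differ, but without a turn a head
  pushing left at 0 is still at 0, and a head moving right beyond \<open>W\<close> is still beyond
  \<open>W\<close>.\<close>

lemma quiet_repeat:
  assumes "quiet A W (config_after A s k)" "k \<le> l" "\<And>i. k \<le> i \<Longrightarrow> i < l \<Longrightarrow> \<not> turn_at A s i"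
    and "\<not> turn_at A s k" and "local_view A (config_after A s k) = local_view A (config_after A s l)"
  shows "quiet A W (config_after A s l) \<and> \<not> turn_at A s l"
proof -
  obtain q act where 1: "transition_at A (config_after A s k) = Some (q, act)" and
    q1: "\<forall>j<num_streams A. snd (act j) = Stay \<or> snd (act j) = Left \<and> position (config_after A s k) j = 0 \<or>
       snd (act j) = Right \<and> W \<le> position (config_after A s k) j"
    using assms(1) unfolding quiet_def by blast
  have 2: "transition_at A (config_after A s l) = Some (q, act)"
    using 1 assms(5) by (simp add: transition_at_local_view)
  have *: "(snd (act j) = Stay \<or> snd (act j) = Left \<and> position (config_after A s l) j = 0 \<or>
       snd (act j) = Right \<and> W \<le> position (config_after A s l) j) \<and>
       \<not> starts_pass (heading (config_after A s l) j) (snd (act j))" if j: "j < num_streams A" for j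
  proof -
    have "\<not> starts_pass (heading (config_after A s k) j) (snd (act j))"
      using not_turn_at_iff[OF 1] assms(4) j by blast
    then show ?thesis using q1 j position_mono[OF j assms(2,3)]
      by (cases "snd (act j)") (force simp: starts_pass_def)+
  qed
  then show ?thesis using 2 not_turn_at_iff[OF 2] unfolding quiet_def by blast
qed

text \<open>The views become periodic with period \<open>b - a\<close>, although the configurations
  need not: a head may run ever further into the blanks.\<close>

lemma quiet_loop:
  assumes "a < b" "local_view A (config_after A s a) = local_view A (config_after A s b)"
    and ba: "\<And>k. a \<le> k \<Longrightarrow> k \<le> b \<Longrightarrow> blank_ahead A W (config_after A s k)"
    and q: "\<And>k. a \<le> k \<Longrightarrow> k < b \<Longrightarrow> quiet A W (config_after A s k) \<and> \<not> turn_at A s k"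
  shows "a \<le> k \<Longrightarrow> \<not> halted A (config_after A s k)"
proof -
  have "quiet A W (config_after A s k) \<and> \<not> turn_at A s k \<and> blank_ahead A W (config_after A s k) \<and>
    (b \<le> k \<longrightarrow> local_view A (config_after A s k) = local_view A (config_after A s (k - (b - a))))"
    if "a \<le> k" for k
    using that
  proof (induction k rule: less_induct)
    case (less k)
    show ?case
    proof (cases "k < b")
      case True
      then show ?thesis using less q[of k] ba[of k] by auto
    next
      case False
      define l where "l = k - (b - a)"
      have l: "a \<le> l" "l < k" using False \<open>a < b\<close> by (auto simp: l_def)
      have nt: "\<not> turn_at A s i" if "l \<le> i" "i < k" for i using less.IH[of i] l that by auto
      have lv: "local_view A (config_after A s l) = local_view A (config_after A s k)"
      proof (cases "k = b")
        case True
        then show ?thesis using assms(1,2) by (simp add: l_def)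
      next
        case F: False
        have "quiet A W (config_after A s (k - 1)) \<and> \<not> turn_at A s (k - 1) \<and> blank_ahead A W (config_after A s (k - 1)) \<and>
           local_view A (config_after A s (k - 1)) = local_view A (config_after A s (k - 1 - (b - a)))"
          using less.IH[of "k - 1"] False F \<open>a < b\<close> by auto
        moreover have "k - 1 - (b - a) = l - 1" by (simp add: l_def)
        moreover have "quiet A W (config_after A s (l - 1))" "blank_ahead A W (config_after A s (l - 1))"
          using less.IH[of "l - 1"] l False F \<open>a < b\<close> by (auto simp: l_def)
        moreover have "config_after A s k = next_config A (config_after A s (k - 1))"
            "config_after A s l = next_config A (config_after A s (l - 1))"
        proof -
          have "k = Suc (k - 1)" "l = Suc (l - 1)" using l False F \<open>a < b\<close> by (auto simp: l_def)
          then show "config_after A s k = next_config A (config_after A s (k - 1))"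
            "config_after A s l = next_config A (config_after A s (l - 1))"
            using config_after_Suc[of A s "k - 1"] config_after_Suc[of A s "l - 1"] by simp_all
        qed
        ultimately show ?thesis using local_view_quiet by metis
      qed
      have "quiet A W (config_after A s k) \<and> \<not> turn_at A s k"
        using quiet_repeat[OF _ _ nt _ lv] less.IH[of l] l by auto
      moreover have "blank_ahead A W (config_after A s k)"
      proof -
        have "k - 1 < k" "a \<le> k - 1" "k = Suc (k - 1)" using l by auto
        then show ?thesis using less.IH[of "k - 1"] blank_ahead_Suc by metis
      qed
      ultimately show ?thesis using lv l_def by simp
    qed
  qed
  then show "a \<le> k \<Longrightarrow> \<not> halted A (config_after A s k)" unfolding quiet_def halted_def by force
qed

text \<open>There are fewer than \<open>2 ^ (m + 1)\<close> memories of at most \<open>m\<close>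
  bits, and \<open>G ^ t\<close> lists of scanned cells.\<close>

definition view_bound :: "nat \<Rightarrow> nat \<Rightarrow> nat \<Rightarrow> nat" where
  "view_bound G t m = 2 ^ (m + 1) * G ^ t"

lemma finite_cell: "finite (UNIV :: ('a::finite, 'g::finite) cell set)"
proof -
  have "(UNIV :: ('a, 'g) cell set) \<subseteq> {Blank} \<union> range Sym \<union> range Work"
  proof
    fix c :: "('a, 'g) cell" show "c \<in> {Blank} \<union> range Sym \<union> range Work" by (cases c) auto
  qed
  then show ?thesis by (rule finite_subset) simp
qed

lemma card_bool_lists: "finite {xs :: bool list. length xs \<le> m}" "card {xs :: bool list. length xs \<le> m} \<le> 2 ^ (m + 1)"
proof -
  have "card {xs :: bool list. set xs \<subseteq> UNIV \<and> length xs \<le> m} = (\<Sum>i\<le>m. card (UNIV :: bool set) ^ i)"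
    by (rule card_lists_length_le) simp
  also have "\<dots> = 2 ^ (m + 1) - 1" by (induction m) auto
  finally show "card {xs :: bool list. length xs \<le> m} \<le> 2 ^ (m + 1)" by simp
  show "finite {xs :: bool list. length xs \<le> m}"
    using finite_lists_length_le[of "UNIV :: bool set" m] by simp
qed

lemma card_views:
  fixes t m :: nat
  defines "V \<equiv> {xs :: bool list. length xs \<le> m} \<times> {cs :: ('a::finite, 'g::finite) cell list. length cs = t}"
  shows "finite V" "card V \<le> view_bound (card (UNIV :: ('a, 'g) cell set)) t m"
proof -
  have "card {cs :: ('a, 'g) cell list. set cs \<subseteq> UNIV \<and> length cs = t} = card (UNIV :: ('a, 'g) cell set) ^ t"
    by (rule card_lists_length_eq) (rule finite_cell)
  then show "card V \<le> view_bound (card (UNIV :: ('a, 'g) cell set)) t m"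
    unfolding V_def view_bound_def using card_bool_lists(2)[of m] by (simp add: card_cartesian_product)
  show "finite V" unfolding V_def
    using finite_lists_length_eq[of "UNIV :: ('a, 'g) cell set" t] finite_cell
    by (intro finite_cartesian_product card_bool_lists(1)) simp
qed

lemma local_view_mem:
  "length (memory C) \<le> m \<Longrightarrow> local_view A C \<in> {xs. length xs \<le> m} \<times> {cs. length cs = num_streams A}"
  by (simp add: local_view_def)

text \<open>Among \<open>Q + 1\<close> configurations two have the same view; if all these steps
  were quiet, the run would loop forever.\<close>

lemma exists_loud_step:
  fixes A :: "('a::finite, 'g::finite) rw_algorithm"
  assumes mem: "\<And>k. length (memory (config_after A s k)) \<le> m"
    and halts: "halted A (config_after A s k')"
    and Q: "Q = view_bound (card (UNIV :: ('a, 'g) cell set)) (num_streams A) m"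
    and ba: "blank_ahead A W (config_after A s k)"
    and nt: "\<And>i. k \<le> i \<Longrightarrow> i \<le> k + Q \<Longrightarrow> \<not> turn_at A s i"
  shows "\<exists>i. k \<le> i \<and> i \<le> k + Q \<and> \<not> quiet A W (config_after A s i)"
proof (rule ccontr)
  assume "\<not> ?thesis"
  then have q: "\<And>i. k \<le> i \<Longrightarrow> i \<le> k + Q \<Longrightarrow> quiet A W (config_after A s i)" by blast
  let ?f = "\<lambda>i. local_view A (config_after A s i)"
  have "\<not> inj_on ?f {k..k + Q}"
  proof
    assume "inj_on ?f {k..k + Q}"
    then have "card {k..k + Q} = card (?f ` {k..k + Q})" by (simp add: card_image)
    also have "\<dots> \<le> card ({xs :: bool list. length xs \<le> m} \<times> {cs :: ('a, 'g) cell list. length cs = num_streams A})"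
      using local_view_mem[OF mem] by (intro card_mono card_views(1)) blast
    also have "\<dots> \<le> Q" unfolding Q by (rule card_views(2))
    finally show False by simp
  qed
  then obtain a b where ab: "k \<le> a" "a < b" "b \<le> k + Q" "?f a = ?f b"
    unfolding inj_on_def by (metis atLeastAtMost_iff linorder_neqE_nat)
  have ba': "blank_ahead A W (config_after A s i)" if "k \<le> i" "i \<le> k + Q" for i
    using that
  proof (induction i rule: dec_induct)
    case (step i)
    then show ?case using blank_ahead_Suc nt[of i] by simp
  qed (rule ba)
  have "\<not> halted A (config_after A s (max a k'))"
    by (rule quiet_loop[OF ab(2,4), of W]) (use ab ba' q nt in auto)
  moreover have "halted A (config_after A s (max a k'))"
    using config_after_halted[OF halts, of "max a k'"] halts by simp
  ultimately show False by simp
qed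

text \<open>The number of moves that the heads can still make within the first \<open>W\<close>
  cells before some head turns. Every step that is not quiet uses up at least one of them.\<close>

definition work_left :: "('a, 'g) rw_algorithm \<Rightarrow> nat \<Rightarrow> ('a, 'g) rw_config \<Rightarrow> nat" where
  "work_left A W C = (\<Sum>j<num_streams A. case heading C j of Left \<Rightarrow> position C j | Right \<Rightarrow> W - position C j | Stay \<Rightarrow> 0)"

lemma work_left_Suc:
  assumes "\<not> turn_at A s k"
  shows "work_left A W (config_after A s (Suc k)) \<le> work_left A W (config_after A s k)"
    and "\<not> halted A (config_after A s k) \<Longrightarrow> \<not> quiet A W (config_after A s k) \<Longrightarrow>
      work_left A W (config_after A s (Suc k)) < work_left A W (config_after A s k)"
proof -
  let ?w = "\<lambda>C j. case heading C j of Left \<Rightarrow> position C j | Right \<Rightarrow> W - position C j | Stay \<Rightarrow> 0"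
  have le: "?w (config_after A s (Suc k)) j \<le> ?w (config_after A s k) j" if j: "j < num_streams A" for j
    using heading_not_turn[OF assms j] heading_of_move[OF j, of "config_after A s k"]
    by (cases "heading (config_after A s k) j") (force simp: config_after_Suc not_less[symmetric])+
  then show "work_left A W (config_after A s (Suc k)) \<le> work_left A W (config_after A s k)"
    unfolding work_left_def by (intro sum_mono) simp
  assume "\<not> halted A (config_after A s k)" and nq: "\<not> quiet A W (config_after A s k)"
  then obtain q act where 1: "transition_at A (config_after A s k) = Some (q, act)"
    by (cases A "config_after A s k" rule: running_cases) auto
  obtain j where j: "j < num_streams A" and act: "\<not> (snd (act j) = Stay \<or> snd (act j) = Left \<and> position (config_after A s k) j = 0 \<or>
       snd (act j) = Right \<and> W \<le> position (config_after A s k) j)"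
    using nq 1 unfolding quiet_def by auto
  have "\<not> starts_pass (heading (config_after A s k) j) (snd (act j))"
    using not_turn_at_iff[OF 1] assms j by blast
  then have "?w (config_after A s (Suc k)) j < ?w (config_after A s k) j"
    using act j heading_not_turn[OF assms j]
    by (cases "snd (act j)") (auto simp: starts_pass_def config_after_Suc next_config_running[OF 1])
  then show "work_left A W (config_after A s (Suc k)) < work_left A W (config_after A s k)"
    unfolding work_left_def using j le by (intro sum_strict_mono_ex1) auto
qed

text \<open>Everything from cell \<open>W\<close> on is blank at time \<open>k0\<close>, and
  \<open>work_left\<close> is then at most \<open>num_streams A * W\<close>. Each stretch of
  \<open>Q + 1\<close> steps contains a step that is not quiet and lowers it, so
  \<open>num_streams A * W + 1\<close> such stretches cannot fit between turns.\<close>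

lemma pass_length:
  fixes A :: "('a::finite, 'g::finite) rw_algorithm"
  assumes mem: "\<And>k. length (memory (config_after A s k)) \<le> m"
    and halts: "halted A (config_after A s k')"
    and Q: "Q = view_bound (card (UNIV :: ('a, 'g) cell set)) (num_streams A) m"
  shows "\<exists>k. k0 \<le> k \<and> k < k0 + (num_streams A * (length s + k0 + 1) + 1) * (Q + 1) \<and>
    (halted A (config_after A s k) \<or> turn_at A s k)"
proof (rule ccontr)
  assume "\<not> ?thesis"
  then have no: "\<not> halted A (config_after A s k)" "\<not> turn_at A s k"
    if "k0 \<le> k" "k < k0 + (num_streams A * (length s + k0 + 1) + 1) * (Q + 1)" for k using that by blast+
  define W where "W = Suc (length s + k0)"
  define I where "I = num_streams A * W + 1"
  have no': "\<not> halted A (config_after A s k)" "\<not> turn_at A s k" if "k0 \<le> k" "k < k0 + I * (Q + 1)" for k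
    using no[of k] that unfolding I_def W_def by auto
  let ?w = "\<lambda>k. work_left A W (config_after A s k)"
  have ba: "blank_ahead A W (config_after A s k)" if "k0 \<le> k" "k < k0 + I * (Q + 1)" for k
    using that
  proof (induction k rule: dec_induct)
    case base
    show ?case unfolding W_def by (rule blank_ahead_initially)
  next
    case (step k)
    then show ?case using blank_ahead_Suc no'(2)[of k] by simp
  qed
  have mono: "?w l \<le> ?w k" if "k0 \<le> k" "k \<le> l" "l \<le> k0 + I * (Q + 1)" for k l
    using that(2,3)
  proof (induction l rule: dec_induct)
    case (step l)
    then show ?case using work_left_Suc(1)[of A s l W] no'(2)[of l] that by simp
  qed simp
  have "?w (k0 + i * (Q + 1)) + i \<le> ?w k0" if "i \<le> I" for i
    using that
  proof (induction i)
    case (Suc i)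
    define k where "k = k0 + i * (Q + 1)"
    have "Suc i * (Q + 1) \<le> I * (Q + 1)" using Suc.prems by (rule mult_le_mono1)
    then have k: "k0 \<le> k" "k + Q + 1 \<le> k0 + I * (Q + 1)" by (auto simp: k_def)
    obtain i' where i': "k \<le> i'" "i' \<le> k + Q" "\<not> quiet A W (config_after A s i')"
      using exists_loud_step[OF mem halts Q, of W k] ba[of k] no'(2) k by auto
    have "?w (Suc i') < ?w i'" using work_left_Suc(2)[of A s i' W] no'[of i'] i' k by auto
    moreover have "?w (k + Q + 1) \<le> ?w (Suc i')" "?w i' \<le> ?w k" using mono i' k by auto
    moreover have "?w k + i \<le> ?w k0" using Suc k_def by simp
    ultimately have "?w (k + Q + 1) + Suc i \<le> ?w k0" by linarith
    moreover have eq: "k0 + Suc i * (Q + 1) = k + Q + 1" by (simp add: k_def)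
    ultimately show ?case unfolding eq by simp
  qed simp
  from this[of I] have "I \<le> ?w k0" by simp
  also have "?w k0 \<le> (\<Sum>j<num_streams A. W)"
    unfolding work_left_def
  proof (rule sum_mono)
    fix j
    show "(case heading (config_after A s k0) j of Left \<Rightarrow> position (config_after A s k0) j
          | Right \<Rightarrow> W - position (config_after A s k0) j | Stay \<Rightarrow> 0) \<le> W"
      using position_le_time[of A s k0 j] by (auto simp: W_def split: move.split)
  qed
  finally show False by (simp add: I_def)
qed

text \<open>The region to be swept is bounded by the input length plus the time elapsed, so each
  pass multiplies \<open>k + n + 2\<close> by at most \<open>Z\<close>. After \<open>r + 1\<close>
  such rounds the run has halted, as it would otherwise have begun \<open>r + 1\<close>
  passes.\<close>

lemma running_time:
  fixes A :: "('a::finite, 'g::finite) rw_algorithm"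
  assumes mem: "\<And>k. length (memory (config_after A s k)) \<le> m"
    and halts: "halted A (config_after A s k')"
    and passes: "\<And>k. total_passes A (config_after A s k) \<le> r"
    and Q: "Q = view_bound (card (UNIV :: ('a, 'g) cell set)) (num_streams A) m"
  shows "halted A (config_after A s ((length s + 2) * (1 + (num_streams A + 1) * (Q + 1)) ^ (r + 1)))"
proof -
  define n where "n = length s"
  define t where "t = num_streams A"
  define Z where "Z = 1 + (t + 1) * (Q + 1)"
  have "\<exists>k. k + n + 2 \<le> (n + 2) * Z ^ h \<and> (halted A (config_after A s k) \<or> h \<le> total_passes A (config_after A s k))" for h
  proof (induction h)
    case 0
    then show ?case by (intro exI[of _ 0]) simp
  next
    case (Suc h)
    then obtain k where k: "k + n + 2 \<le> (n + 2) * Z ^ h"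
      "halted A (config_after A s k) \<or> h \<le> total_passes A (config_after A s k)" by blast
    have step: "(k + n + 2) * Z \<le> (n + 2) * Z ^ Suc h" using mult_le_mono1[OF k(1), of Z] by (simp add: mult_ac)
    have "k + n + 2 \<le> (k + n + 2) * Z" by (simp add: Z_def)
    with step have k': "k + n + 2 \<le> (n + 2) * Z ^ Suc h" by linarith
    show ?case
    proof (cases "halted A (config_after A s k)")
      case True
      then show ?thesis using k' by blast
    next
      case False
      obtain l where l: "k \<le> l" "l < k + (t * (n + k + 1) + 1) * (Q + 1)"
        "halted A (config_after A s l) \<or> turn_at A s l"
        using pass_length[OF mem halts Q, of k] unfolding n_def t_def by blast
      have "(t * (n + k + 1) + 1) * (Q + 1) \<le> ((t + 1) * (n + k + 2)) * (Q + 1)"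
        by (intro mult_le_mono1) (simp add: algebra_simps)
      then have "Suc l + n + 2 \<le> (k + n + 2) + ((t + 1) * (n + k + 2)) * (Q + 1)" using l(2) by linarith
      also have "\<dots> = (k + n + 2) * Z" by (simp add: Z_def algebra_simps)
      finally have bound: "Suc l + n + 2 \<le> (n + 2) * Z ^ Suc h" using step by linarith
      have mono: "total_passes A (config_after A s i) \<le> total_passes A (config_after A s (Suc i))" for i
        unfolding total_passes_def by (rule sum_mono) (simp add: config_after_Suc num_passes_mono)
      show ?thesis
      proof (cases "halted A (config_after A s l)")
        case True
        then show ?thesis using bound by (intro exI[of _ l]) auto
      next
        case F: False
        have "total_passes A (config_after A s k) \<le> total_passes A (config_after A s l)"
          using lift_Suc_mono_le[of "\<lambda>i. total_passes A (config_after A s i)", OF mono l(1)] .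
        then have "Suc h \<le> total_passes A (config_after A s (Suc l))"
          using mono[of l] l(3) F k(2) False unfolding turn_at_def by auto
        then show ?thesis using bound by blast
      qed
    qed
  qed
  then obtain k where k: "k + n + 2 \<le> (n + 2) * Z ^ (r + 1)"
    "halted A (config_after A s k) \<or> r + 1 \<le> total_passes A (config_after A s k)" by blast
  then have "halted A (config_after A s k)" using passes[of k] by auto
  then have "config_after A s ((n + 2) * Z ^ (r + 1)) = config_after A s k"
    by (rule config_after_halted) (use k(1) in simp)
  then show ?thesis using \<open>halted A (config_after A s k)\<close> unfolding Z_def n_def t_def by simp
qed

subsection \<open>Traces\<close>

definition run_tag :: "('a, 'g) rw_algorithm \<Rightarrow> (nat \<Rightarrow> nat \<Rightarrow> nat set) \<Rightarrow> 'a list \<Rightarrow> nat \<Rightarrow> nat \<Rightarrow> nat \<Rightarrow> nat set" where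
  "run_tag A tag0 s =
     tagged_sweeps.tag (num_streams A) (\<lambda>k. position (config_after A s k)) tag0"

definition run_events :: "('a, 'g) rw_algorithm \<Rightarrow> (nat \<Rightarrow> nat \<Rightarrow> nat set) \<Rightarrow> 'a list \<Rightarrow> nat \<Rightarrow> nat set" where
  "run_events A tag0 s N =
     tagged_sweeps.events (num_streams A) (\<lambda>k. position (config_after A s k)) (turn_at A s) tag0 0 N"

text \<open>The time is included so that the snapshots of two equal traces can be matched one by
  one.\<close>

definition snapshot :: "('a, 'g) rw_algorithm \<Rightarrow> 'a list \<Rightarrow> nat \<Rightarrow>
    nat \<times> nat list \<times> bool list \<times> ('a, 'g) cell list" where
  "snapshot A s k = (k, map (position (config_after A s k)) [0..<num_streams A],
     local_view A (config_after A s k))"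

text \<open>Time \<open>N\<close> is added to the events so that the end of the last segment is
  recorded as well, and with it the extent of the region swept there.\<close>

definition trace :: "('a, 'g) rw_algorithm \<Rightarrow> (nat \<Rightarrow> nat \<Rightarrow> nat set) \<Rightarrow> 'a list \<Rightarrow> nat \<Rightarrow>
    (nat \<times> nat list \<times> bool list \<times> ('a, 'g) cell list) set" where
  "trace A tag0 s N = snapshot A s ` insert N (run_events A tag0 s N)"

lemma stream_unvisited:
  assumes "k \<le> l" "\<And>i. k \<le> i \<Longrightarrow> i < l \<Longrightarrow> position (config_after A s i) j \<noteq> p"
  shows "stream (config_after A s l) j p = stream (config_after A s k) j p"
  using assms
proof (induction l rule: dec_induct)
  case (step l)
  have "position (config_after A s l) j \<noteq> p" using step by auto
  then have "stream (config_after A s (Suc l)) j p = stream (config_after A s l) j p"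
    by (cases A "config_after A s l" rule: running_cases)
      (auto simp: config_after_Suc next_config_halted next_config_running)
  then show ?case using step by simp
qed simp

lemma next_config_same_view:
  assumes "local_view A C = local_view A C'" "position C j = position C' j"
  shows "memory (next_config A C) = memory (next_config A C')"
    and "position (next_config A C) j = position (next_config A C') j"
    and "stream C j p = stream C' j p \<Longrightarrow> stream (next_config A C) j p = stream (next_config A C') j p"
proof -
  have eq: "transition_at A C = transition_at A C'" using assms(1) by (simp add: transition_at_local_view)
  have "memory (next_config A C) = memory (next_config A C') \<and>
    position (next_config A C) j = position (next_config A C') j \<and>
    (stream C j p = stream C' j p \<longrightarrow> stream (next_config A C) j p = stream (next_config A C') j p)"
  proof (cases A C rule: running_cases)
    case 1
    then have "halted A C'" using eq by (simp add: halted_def)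
    then show ?thesis using 1 assms local_view_eqD(1)[OF assms(1)] by (simp add: next_config_halted)
  next
    case (2 q act)
    then have "transition_at A C' = Some (q, act)" using eq by simp
    then show ?thesis using 2 assms(2) by (simp add: next_config_running)
  qed
  then show "memory (next_config A C) = memory (next_config A C')"
    "position (next_config A C) j = position (next_config A C') j"
    "stream C j p = stream C' j p \<Longrightarrow> stream (next_config A C) j p = stream (next_config A C') j p"
    by blast+
qed

text \<open>Between two consecutive events the runs on \<open>x\<close> and \<open>y\<close> either read only cells that do not
  depend on block \<open>i\<close>, and then proceed identically, or mark everything they visit as dependent on
  block \<open>i\<close>; in both cases the visited region is known from the trace.\<close>

lemma trace_determines:
  assumes tr: "trace A tag0 x N = trace A tag0 y N" and "0 < N"
  shows "j < num_streams A \<Longrightarrow> run_tag A tag0 x N j p = run_tag A tag0 y N j p"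
    and "(\<And>j p. j < num_streams A \<Longrightarrow> i \<notin> tag0 j p \<Longrightarrow>
       stream (initial_config A x) j p = stream (initial_config A y) j p) \<Longrightarrow>
     j < num_streams A \<Longrightarrow> i \<notin> run_tag A tag0 x N j p \<Longrightarrow>
     stream (config_after A x N) j p = stream (config_after A y N) j p"
proof -
  define t where "t = num_streams A"
  interpret X: tagged_sweeps t "\<lambda>k. position (config_after A x k)" "turn_at A x" tag0
    unfolding t_def by (rule tagged_sweeps_run)
  interpret Y: tagged_sweeps t "\<lambda>k. position (config_after A y k)" "turn_at A y" tag0
    unfolding t_def by (rule tagged_sweeps_run)
  define init where "init \<longleftrightarrow> (\<forall>j p. j < t \<longrightarrow> i \<notin> tag0 j p \<longrightarrow>
       stream (initial_config A x) j p = stream (initial_config A y) j p)"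
  define E where "E = insert N (X.events 0 N)"
  have trX: "trace A tag0 x N = snapshot A x ` insert N (X.events 0 N)"
    by (simp add: trace_def run_events_def t_def)
  have trY: "trace A tag0 y N = snapshot A y ` insert N (Y.events 0 N)"
    by (simp add: trace_def run_events_def t_def)
  have fstX: "fst ` trace A tag0 x N = insert N (X.events 0 N)"
    unfolding trX image_image by (simp add: snapshot_def)
  have fstY: "fst ` trace A tag0 y N = insert N (Y.events 0 N)"
    unfolding trY image_image by (simp add: snapshot_def)
  \<comment> \<open>Events lie strictly before \<open>N\<close>, so removing \<open>N\<close> from
    the recorded times recovers them.\<close>
  have "N \<notin> X.events 0 N" "N \<notin> Y.events 0 N" by (auto simp: X.events_def Y.events_def)
  then have ev: "X.events 0 N = Y.events 0 N" using fstX fstY tr by (metis insert_ident)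
  then have ev': "X.event e \<longleftrightarrow> Y.event e" if "e < N" for e
    using that unfolding X.events_def Y.events_def by auto
  have snap: "snapshot A x k = snapshot A y k" if "k \<in> E" for k
  proof -
    have "snapshot A x k \<in> trace A tag0 y N" using that unfolding E_def tr[symmetric] trX by blast
    then obtain k' where "snapshot A x k = snapshot A y k'" unfolding trY by blast
    moreover from this have "k' = k" by (simp add: snapshot_def)
    ultimately show ?thesis by simp
  qed
  have posE: "position (config_after A x k) j = position (config_after A y k) j" if "k \<in> E" "j < t" for k j
    using snap[OF that(1)] that(2) by (simp add: snapshot_def t_def)
  have viewE: "local_view A (config_after A x k) = local_view A (config_after A y k)" if "k \<in> E" for k
    using snap[OF that] by (simp add: snapshot_def)
  define same where "same k \<longleftrightarrow> (\<forall>j<t. X.reading k j = Y.reading k j \<and> (\<forall>p. X.tag k j p = Y.tag k j p \<and>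
     (init \<longrightarrow> i \<notin> X.tag k j p \<longrightarrow> stream (config_after A x k) j p = stream (config_after A y k) j p)))" for k
  have main: "k \<in> E \<Longrightarrow> same k" for k
  proof (induction k rule: less_induct)
    case (less k)
    show ?case
    proof (cases "k = 0")
      case True
      then have "position (config_after A x 0) j = position (config_after A y 0) j" if "j < t" for j
        using posE[OF less.prems that] by simp
      then show ?thesis using True unfolding same_def init_def by simp
    next
      case False
      have kN: "k \<le> N" using less.prems by (auto simp: E_def X.events_def)
      define k1 where "k1 = Max {e. e < k \<and> X.event e}"
      have fin: "finite {e. e < k \<and> X.event e}" by simp
      have "0 \<in> {e. e < k \<and> X.event e}" using False by (simp add: X.event_def)
      then have "k1 \<in> {e. e < k \<and> X.event e}" unfolding k1_def using Max_in[OF fin] by blast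
      then have k1: "k1 < k" "X.event k1" by auto
      have noX: "\<not> X.event e" if "k1 < e" "e < k" for e
      proof
        assume "X.event e"
        then have "e \<le> k1" unfolding k1_def by (intro Max_ge[OF fin]) (use that in simp)
        then show False using that by simp
      qed
      then have noY: "\<not> Y.event e" if "k1 < e" "e < k" for e using ev'[of e] that kN by auto
      have k1E: "k1 \<in> E" using k1 kN by (auto simp: E_def X.events_def)
      have IH: "same k1" using less.IH k1 k1E by blast
      have tfX: "X.turn_free k1 l" if "k1 \<le> l" "l \<le> k" for l
        unfolding X.turn_free_def using that noX by (auto simp: X.event_def)
      have tfY: "Y.turn_free k1 l" if "k1 \<le> l" "l \<le> k" for l
        unfolding Y.turn_free_def using that noY by (auto simp: Y.event_def)
      have seenX: "X.seen l = X.seen k1" "j < t \<Longrightarrow> X.reading l j = X.reading k1 j" if "k1 \<le> l" "l < k" for l j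
        using X.seen_constant[OF that(1)] noX that by auto
      have seenY: "Y.seen l = Y.seen k1" if "k1 \<le> l" "l < k" for l
        using Y.seen_constant(2)[OF that(1)] noY that by auto
      have seenXY: "X.seen k1 = Y.seen k1" unfolding X.seen_def Y.seen_def using IH by (auto simp: same_def)
      have rd: "X.reading k j = Y.reading k j" if "j < t" for j
      proof -
        have le: "k1 \<le> k" "k \<le> k" using k1(1) by auto
        have "X.reading k1 j = Y.reading k1 j" "X.tag k1 j p = Y.tag k1 j p" for p
          using IH that unfolding same_def by blast+
        then show ?thesis
          unfolding X.reading_turn_free[OF tfX[OF le] that] Y.reading_turn_free[OF tfY[OF le] that]
            posE[OF k1E that] posE[OF less.prems that] by simp
      qed
      have reach: "X.reach k1 k j = Y.reach k1 k j" if "j < t" for j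
        unfolding X.reach_def Y.reach_def using posE[OF k1E that] posE[OF less.prems that] by simp
      \<comment> \<open>No reading changes strictly between \<open>k1\<close> and \<open>k\<close>,
        so the whole swept region receives the single tag \<open>seen k1\<close>; its extent follows
        from the recorded positions at both ends.\<close>
      have insX: "X.tag k j p = X.seen k1" if "j < t" "p \<in> X.reach k1 k j" for j p
        using X.tag_inside_reach[OF tfX[of k] k1(1) that] k1(1) seenX(1) by (metis less_imp_le order_refl)
      have insY: "Y.tag k j p = Y.seen k1" if "j < t" "p \<in> Y.reach k1 k j" for j p
        using Y.tag_inside_reach[OF tfY[of k] k1(1) that] k1(1) seenY by (metis less_imp_le order_refl)
      have tags: "X.tag k j p = Y.tag k j p" if "j < t" for j p
      proof (cases "p \<in> X.reach k1 k j")
        case True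
        then show ?thesis using insX[OF that] insY[OF that] reach[OF that] seenXY by simp
      next
        case False
        then show ?thesis using X.tag_outside_reach[OF tfX[of k] that] Y.tag_outside_reach[OF tfY[of k] that]
          reach[OF that] IH that k1(1) by (simp add: same_def)
      qed
      have cells: "stream (config_after A x k) j p = stream (config_after A y k) j p"
        if init: "init" and jp: "j < t" "i \<notin> X.tag k j p" for j p
      proof (cases "i \<in> X.seen k1")
        case True
        then have out: "p \<notin> X.reach k1 k j" using jp insX by auto
        have "stream (config_after A x k) j p = stream (config_after A x k1) j p"
          by (rule stream_unvisited) (use out X.pos_in_reach[OF tfX[of k] jp(1)] k1(1) in force)+
        moreover have "stream (config_after A y k) j p = stream (config_after A y k1) j p"
          by (rule stream_unvisited)
            (use out reach[OF jp(1)] Y.pos_in_reach[OF tfY[of k] jp(1)] k1(1) in force)+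
        moreover have "i \<notin> X.tag k1 j p" using jp out X.tag_outside_reach[OF tfX[of k] jp(1) out] k1(1) by simp
        ultimately show ?thesis using IH init jp by (simp add: same_def)
      next
        case False
        have "(\<forall>j<t. \<forall>p. i \<notin> X.tag l j p \<longrightarrow> stream (config_after A x l) j p = stream (config_after A y l) j p) \<and>
          (\<forall>j<t. position (config_after A x l) j = position (config_after A y l) j) \<and>
          local_view A (config_after A x l) = local_view A (config_after A y l)"
          if "k1 \<le> l" "l \<le> k" for l
          using that
        proof (induction l rule: dec_induct)
          case base
          then show ?case using IH init posE[OF k1E] viewE[OF k1E] by (simp add: same_def)
        next
          case (step l)
          let ?x = "config_after A x l" and ?y = "config_after A y l"
          have l: "k1 \<le> l" "l < k" using step by auto
          have view: "local_view A ?x = local_view A ?y" and pos: "\<And>j. j < t \<Longrightarrow> position ?x j = position ?y j"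
            and cell: "\<And>j p. j < t \<Longrightarrow> i \<notin> X.tag l j p \<Longrightarrow> stream ?x j p = stream ?y j p"
            using step by auto
          have pos': "position (next_config A ?x) j = position (next_config A ?y) j" if "j < t" for j
            using next_config_same_view(2)[OF view pos[OF that]] .
          have inS: "i \<notin> X.seen l" using seenX(1)[OF l] False by simp
          \<comment> \<open>Only at the next recorded time \<open>k\<close> may a head enter a cell
            of another tag, and there the snapshot supplies the symbol scanned. At any earlier time
            the cell entered has the same tag as the previous reading, which does not contain
            \<open>i\<close>.\<close>
          have head: "stream (next_config A ?x) j (position (next_config A ?x) j) =
            stream (next_config A ?y) j (position (next_config A ?x) j)" if "j < t" for j
          proof (cases "Suc l = k")
            case True
            then have "Suc l \<in> E" using less.prems by simp
            then have "local_view A (next_config A ?x) = local_view A (next_config A ?y)"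
              using viewE[of "Suc l"] by (simp add: config_after_Suc)
            then show ?thesis using local_view_eqD(2) pos'[OF that] that unfolding t_def by metis
          next
            case neq: False
            have "stream ?x j (position (next_config A ?x) j) = stream ?y j (position (next_config A ?x) j)"
            proof (cases "position (next_config A ?x) j = position ?x j")
              case True
              then show ?thesis using local_view_eqD(2)[OF view, of j] pos[OF that] that unfolding t_def by simp
            next
              case moved: False
              then have "X.tag l j (position (next_config A ?x) j) = X.reading (Suc l) j"
                by (simp add: X.reading_Suc config_after_Suc)
              also have "\<dots> = X.reading l j" using seenX(2)[of "Suc l" j] seenX(2)[of l j] l neq that by auto
              also have "\<dots> \<subseteq> X.seen l" using that by (auto simp: X.seen_def)
              finally show ?thesis using inS cell[OF that] by blast
            qed
            then show ?thesis using next_config_same_view(3)[OF view pos[OF that]] by blast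
          qed
          have cell': "stream (next_config A ?x) j p = stream (next_config A ?y) j p"
            if "j < t" "i \<notin> X.tag (Suc l) j p" for j p
          proof (cases "p = position (next_config A ?x) j")
            case True
            then show ?thesis using head[OF that(1)] by simp
          next
            case False
            show ?thesis
            proof (cases "p = position ?x j")
              case True
              then have "stream ?x j p = stream ?y j p"
                using local_view_eqD(2)[OF view, of j] pos[OF that(1)] that unfolding t_def by simp
              then show ?thesis using next_config_same_view(3)[OF view pos[OF that(1)]] by blast
            next
              case F: False
              then have "i \<notin> X.tag l j p" using that False by (simp add: X.tag_Suc config_after_Suc)
              then show ?thesis using next_config_same_view(3)[OF view pos[OF that(1)]] cell[OF that(1)] by blast
            qed
          qed
          have "local_view A (next_config A ?x) = local_view A (next_config A ?y)"
          proof (rule local_view_eqI)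
            show "memory (next_config A ?x) = memory (next_config A ?y)"
              using view by (metis local_view_eqD(1) next_config_halted next_config_running(1) running_cases transition_at_local_view)
            show "stream (next_config A ?x) j (position (next_config A ?x) j) =
              stream (next_config A ?y) j (position (next_config A ?y) j)" if "j < num_streams A" for j
              using head[of j] pos'[of j] that unfolding t_def by simp
          qed
          then show ?case using cell' pos' by (simp add: config_after_Suc)
        qed
        then show ?thesis using jp k1(1) by auto
      qed
      show ?thesis unfolding same_def using rd tags cells by blast
    qed
  qed
  have sN: "same N" by (rule main) (simp add: E_def)
  have rt: "run_tag A tag0 x N = X.tag N" "run_tag A tag0 y N = Y.tag N"
    by (simp_all add: run_tag_def t_def)
  show "j < num_streams A \<Longrightarrow> run_tag A tag0 x N j p = run_tag A tag0 y N j p"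
    using sN unfolding rt same_def t_def by simp
  assume "\<And>j p. j < num_streams A \<Longrightarrow> i \<notin> tag0 j p \<Longrightarrow>
       stream (initial_config A x) j p = stream (initial_config A y) j p"
  then have "init" by (simp add: init_def t_def)
  then show "j < num_streams A \<Longrightarrow> i \<notin> run_tag A tag0 x N j p \<Longrightarrow>
     stream (config_after A x N) j p = stream (config_after A y N) j p"
    using sN unfolding rt same_def t_def by simp
qed

section \<open>Number of traces\<close>

lemma card_small_subsets:
  assumes "finite U"
  shows "finite {X. X \<subseteq> U \<and> card X \<le> e}" "card {X. X \<subseteq> U \<and> card X \<le> e} \<le> (card U + 1) ^ e"
proof -
  \<comment> \<open>Each subset is listed and padded with \<open>None\<close> to length exactly
    \<open>e\<close>.\<close>
  define L where "L = {l :: 'a option list. set l \<subseteq> insert None (Some ` U) \<and> length l = e}"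
  have fin: "finite (insert None (Some ` U))" using assms by simp
  have "card (insert None (Some ` U)) = card U + 1"
    using assms by (simp add: card_image)
  then have L: "finite L" "card L = (card U + 1) ^ e"
    unfolding L_def using card_lists_length_eq[OF fin, of e] finite_lists_length_eq[OF fin, of e] by simp_all
  have sub: "{X. X \<subseteq> U \<and> card X \<le> e} \<subseteq> (\<lambda>l. {u. Some u \<in> set l}) ` L"
  proof
    fix X assume "X \<in> {X. X \<subseteq> U \<and> card X \<le> e}"
    then have X: "X \<subseteq> U" "card X \<le> e" by auto
    then obtain xs where xs: "set xs = X" "distinct xs"
      using finite_distinct_list finite_subset[OF X(1) assms] by blast
    then have len: "length xs \<le> e" using X(2) distinct_card by metis
    define l where "l = map Some xs @ replicate (e - length xs) None"
    have "l \<in> L" using len xs X unfolding L_def l_def by (auto simp: set_replicate_conv_if)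
    moreover have "X = {u. Some u \<in> set l}" using xs by (auto simp: l_def set_replicate_conv_if)
    ultimately show "X \<in> (\<lambda>l. {u. Some u \<in> set l}) ` L" by blast
  qed
  show "finite {X. X \<subseteq> U \<and> card X \<le> e}" using sub L(1) finite_surj by blast
  have "card {X. X \<subseteq> U \<and> card X \<le> e} \<le> card ((\<lambda>l. {u. Some u \<in> set l}) ` L)"
    using sub L(1) by (intro card_mono) auto
  also have "\<dots> \<le> (card U + 1) ^ e" using L card_image_le by metis
  finally show "card {X. X \<subseteq> U \<and> card X \<le> e} \<le> (card U + 1) ^ e" .
qed

text \<open>In \<open>M\<close> one factor \<open>N + 1\<close> counts the times,
  \<open>num_streams A\<close> further ones the head positions, and \<open>view_bound\<close> the
  memory together with the scanned cells. The exponent \<open>e + 1\<close> includes the snapshot at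
  time \<open>N\<close>.\<close>

lemma card_traces:
  fixes A :: "('a::finite, 'g::finite) rw_algorithm"
  assumes mem: "\<And>s k. s \<in> S \<Longrightarrow> length (memory (config_after A s k)) \<le> m"
    and ev: "\<And>s. s \<in> S \<Longrightarrow> card (run_events A tag0 s N) \<le> e"
  defines "M \<equiv> (N + 1) ^ (num_streams A + 1) * view_bound (card (UNIV :: ('a, 'g) cell set)) (num_streams A) m"
  shows "finite ((\<lambda>s. trace A tag0 s N) ` S) \<and> card ((\<lambda>s. trace A tag0 s N) ` S) \<le> (M + 1) ^ (e + 1)"
proof -
  define V where "V = {xs :: bool list. length xs \<le> m} \<times> {cs :: ('a, 'g) cell list. length cs = num_streams A}"
  define P where "P = {ps :: nat list. set ps \<subseteq> {..N} \<and> length ps = num_streams A}"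
  define U where "U = {..N} \<times> P \<times> V"
  have V: "finite V" "card V \<le> view_bound (card (UNIV :: ('a, 'g) cell set)) (num_streams A) m"
    unfolding V_def using card_views by blast+
  have P: "finite P" "card P = (N + 1) ^ num_streams A"
    unfolding P_def using card_lists_length_eq[of "{..N}"] finite_lists_length_eq[of "{..N}"] by simp_all
  have finU: "finite U" using V P by (simp add: U_def)
  have "card U = (N + 1) * ((N + 1) ^ num_streams A * card V)"
    by (simp add: U_def card_cartesian_product P)
  also have "\<dots> \<le> (N + 1) * ((N + 1) ^ num_streams A * view_bound (card (UNIV :: ('a, 'g) cell set)) (num_streams A) m)"
    by (intro mult_le_mono order_refl V(2))
  also have "\<dots> = M" by (simp only: M_def power_add power_one_right mult_ac)
  finally have cU: "card U \<le> M" .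
  have sub: "(\<lambda>s. trace A tag0 s N) ` S \<subseteq> {X. X \<subseteq> U \<and> card X \<le> e + 1}"
  proof (clarify, intro conjI)
    fix s assume s: "s \<in> S"
    have fin: "finite (run_events A tag0 s N)" "run_events A tag0 s N \<subseteq> {..N}"
      unfolding run_events_def tagged_sweeps.events_def[OF tagged_sweeps_run] by auto
    have "snapshot A s k \<in> U" if "k \<le> N" for k
    proof -
      have "set (map (position (config_after A s k)) [0..<num_streams A]) \<subseteq> {..N}"
        using position_le_time[of A s k] that order_trans by fastforce
      then show ?thesis
        using that local_view_mem[OF mem[OF s, of k], of A] by (simp add: U_def P_def V_def snapshot_def)
    qed
    then show "trace A tag0 s N \<subseteq> U" using fin(2) unfolding trace_def by auto
    have "card (trace A tag0 s N) \<le> card (insert N (run_events A tag0 s N))"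
      unfolding trace_def using fin by (intro card_image_le) simp
    also have "\<dots> \<le> e + 1" using card_insert_le_m1[of "e + 1" "run_events A tag0 s N" N] ev[OF s] by simp
    finally show "card (trace A tag0 s N) \<le> e + 1" .
  qed
  have "card ((\<lambda>s. trace A tag0 s N) ` S) \<le> card {X. X \<subseteq> U \<and> card X \<le> e + 1}"
    using sub card_small_subsets(1)[OF finU] by (intro card_mono)
  also have "\<dots> \<le> (card U + 1) ^ (e + 1)" by (rule card_small_subsets(2)[OF finU])
  also have "\<dots> \<le> (M + 1) ^ (e + 1)" using cU by (intro power_mono) auto
  finally show ?thesis using sub card_small_subsets(1)[OF finU] finite_subset by blast
qed

section \<open>Tags of the input blocks\<close>

definition block_tag :: "nat \<Rightarrow> nat \<Rightarrow> nat \<Rightarrow> nat \<Rightarrow> nat set" where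
  "block_tag n b j p = (if j = 0 \<and> p < n then {p div b} else {})"

lemma changes_block_tag:
  assumes "0 < b"
  shows "finite (changes (block_tag (q * b) b j))" "card (changes (block_tag (q * b) b j)) \<le> (if j = 0 then q else 0)"
proof -
  have sub: "changes (block_tag (q * b) b j) \<subseteq> (if j = 0 then (\<lambda>i. (i + 1) * b - 1) ` {..<q} else {})"
  proof
    fix p assume "p \<in> changes (block_tag (q * b) b j)"
    then have ne: "block_tag (q * b) b j p \<noteq> block_tag (q * b) b j (Suc p)" by (simp add: changes_def)
    then have j: "j = 0" and p: "p < q * b" by (auto simp: block_tag_def split: if_splits)
    have "b dvd Suc p"
    proof (cases "Suc p < q * b")
      case True
      then have "p div b \<noteq> Suc p div b" using ne p j by (simp add: block_tag_def)
      then show ?thesis by (metis div_Suc dvd_eq_mod_eq_0)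
    next
      case False
      then have "Suc p = q * b" using p by simp
      then show ?thesis by simp
    qed
    then obtain c where c: "Suc p = b * c" by (elim dvdE)
    then obtain i where i: "c = Suc i" by (cases c) auto
    have "b * c \<le> b * q" using p c by (metis Suc_leI mult.commute)
    then have "i < q" using i assms by (metis Suc_le_lessD mult_le_cancel1)
    moreover have "p = (i + 1) * b - 1" using c i by (simp add: mult.commute)
    ultimately show "p \<in> (if j = 0 then (\<lambda>i. (i + 1) * b - 1) ` {..<q} else {})" using j by auto
  qed
  have fin: "finite (if j = 0 then (\<lambda>i. (i + 1) * b - 1) ` {..<q} else {})" by simp
  show "finite (changes (block_tag (q * b) b j))" using finite_subset[OF sub fin] .
  have "card (changes (block_tag (q * b) b j)) \<le> card (if j = 0 then (\<lambda>i. (i + 1) * b - 1) ` {..<q} else {})"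
    using card_mono[OF fin sub] .
  also have "\<dots> \<le> (if j = 0 then q else 0)" using card_image_le[of "{..<q}" "\<lambda>i. (i + 1) * b - 1"] by simp
  finally show "card (changes (block_tag (q * b) b j)) \<le> (if j = 0 then q else 0)" .
qed

text \<open>The blocks stand on the first stream in increasing order, so one chain suffices. All
  other cells are initially blank and depend on no block.\<close>

lemma chain_cover_block_tag: "chain_cover 1 (block_tag n b j)"
  unfolding chain_cover_def
proof (intro exI conjI)
  let ?X = "{(p, p div b) | p. True}"
  show "\<forall>X\<in>{?X}. monotonic_chain X" by (auto simp: monotonic_chain_def div_le_mono)
  show "{(p, i). i \<in> block_tag n b j p} \<subseteq> \<Union>{?X}" by (auto simp: block_tag_def split: if_splits)
qed simp_all

lemma run_structure:
  fixes A :: "('a, 'g) rw_algorithm" and r q b N :: nat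
  assumes passes: "\<And>k. total_passes A (config_after A s k) \<le> r" and "0 < b"
  defines "t \<equiv> num_streams A"
  shows "j < t \<Longrightarrow> chain_cover ((2 * t + 2) ^ (r + 1)) (run_tag A (block_tag (q * b) b) s N j)"
    and "card (run_events A (block_tag (q * b) b) s N) \<le> (2 * t + 2) ^ (r + 1) * (q + 2 * t + 3)"
proof -
  interpret tagged_sweeps t "\<lambda>k. position (config_after A s k)" "turn_at A s" "block_tag (q * b) b"
    unfolding t_def by (rule tagged_sweeps_run)
  have "turns N \<le> r" unfolding turns_def using turns_le_total_passes[of N A s] passes[of N] by linarith
  then have le: "(2 * t + 2) ^ (turns N + 1) \<le> (2 * t + 2) ^ (r + 1)" by (intro power_increasing) auto
  have S: "(\<forall>j<t. finite (changes (tag N j)) \<and> chain_cover ((2 * t + 2) ^ (turns N + 1)) (tag N j) \<and>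
      finite (reading N j) \<and> card (reading N j) \<le> (2 * t + 2) ^ (turns N + 1)) \<and>
    complexity N \<le> (2 * t + 2) ^ (turns N + 1) * complexity 0"
    by (rule tag_structure) (use chain_cover_block_tag changes_block_tag[OF \<open>0 < b\<close>] in auto)
  have tag: "run_tag A (block_tag (q * b) b) s N = tag N" by (simp add: run_tag_def t_def)
  show "j < t \<Longrightarrow> chain_cover ((2 * t + 2) ^ (r + 1)) (run_tag A (block_tag (q * b) b) s N j)"
    using S le chain_cover_mono unfolding tag by blast
  have "(\<Sum>j<t. card (changes (block_tag (q * b) b j))) \<le> (\<Sum>j<t. if j = 0 then q else 0)"
    by (rule sum_mono) (rule changes_block_tag(2)[OF \<open>0 < b\<close>])
  also have "\<dots> \<le> q" by (simp add: sum.delta)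
  finally have "complexity 0 \<le> q + 2 * t + 3" by (simp add: complexity_def events_def)
  then have "complexity N \<le> (2 * t + 2) ^ (r + 1) * (q + 2 * t + 3)"
    using S le by (meson mult_le_mono order_trans)
  then show "card (run_events A (block_tag (q * b) b) s N) \<le> (2 * t + 2) ^ (r + 1) * (q + 2 * t + 3)"
    unfolding run_events_def t_def[symmetric] complexity_def by linarith
qed

section \<open>Monotone chains against the transposed order of the blocks\<close>

definition transposition :: "nat \<Rightarrow> nat \<Rightarrow> nat" where
  "transposition a i = (i mod a) * a + i div a"

text \<open>Let block \<open>i\<close> have row \<open>i div a\<close> and column
  \<open>i mod a\<close>. Along an increasing chain a larger column goes with a row that is not
  smaller, so row plus column is injective and takes values below \<open>2 * a\<close>. A decreasing
  chain meets at most one block of each column. Together the chains meet at most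
  \<open>2 * a * K < a * a\<close> blocks.\<close>

lemma untouched_block:
  assumes cov: "chain_cover K f" and K: "2 * K < a"
  shows "\<exists>i<a * a. \<forall>p. d + transposition a i * L \<le> p \<longrightarrow> p < d + transposition a i * L + L \<longrightarrow> i \<notin> f p"
proof -
  obtain \<F> where F: "finite \<F>" "card \<F> \<le> K" "\<And>X. X \<in> \<F> \<Longrightarrow> monotonic_chain X"
    "{(p, i). i \<in> f p} \<subseteq> \<Union>\<F>"
    using cov unfolding chain_cover_def by blast
  define J where "J X = {i. i < a * a \<and> (\<exists>p. d + transposition a i * L \<le> p \<and> p < d + transposition a i * L + L \<and> (p, i) \<in> X)}"
    for X :: "(nat \<times> nat) set"
  have finJ: "finite (J X)" for X unfolding J_def by simp
  have "0 < a" using K by simp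
  have less: "transposition a i < transposition a i'"
    if "i < a * a" "i' < a * a" "i mod a < i' mod a \<or> i mod a = i' mod a \<and> i div a < i' div a" for i i'
  proof -
    have "i div a < a" using that(1) by (simp add: less_mult_imp_div_less)
    moreover have "i mod a < i' mod a \<Longrightarrow> i mod a * a + a \<le> i' mod a * a"
      using mult_le_mono1[of "Suc (i mod a)" "i' mod a" a] by simp
    ultimately show ?thesis using that(3) unfolding transposition_def by auto
  qed
  have cJ: "card (J X) \<le> 2 * a" if X: "X \<in> \<F>" for X
  proof -
    have pos: "\<exists>p p'. p < p' \<and> (p, i) \<in> X \<and> (p', i') \<in> X"
      if iJ: "i \<in> J X" "i' \<in> J X" and lt: "transposition a i < transposition a i'" for i i'
    proof -
      obtain p where p: "p < d + transposition a i * L + L" "(p, i) \<in> X"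
        using iJ(1) unfolding J_def by blast
      obtain p' where p': "d + transposition a i' * L \<le> p'" "(p', i') \<in> X"
        using iJ(2) unfolding J_def by blast
      have "transposition a i * L + L \<le> transposition a i' * L"
        using mult_le_mono1[of "Suc (transposition a i)" "transposition a i'" L] lt by simp
      then have "p < p'" using p p' by linarith
      then show ?thesis using p p' by blast
    qed
    from F(3)[OF X] show ?thesis unfolding monotonic_chain_def
    proof
      assume m: "\<forall>p i p' i'. (p, i) \<in> X \<longrightarrow> (p', i') \<in> X \<longrightarrow> p \<le> p' \<longrightarrow> i \<le> i'"
      have key: "i div a + i mod a \<noteq> i' div a + i' mod a" if "i \<in> J X" "i' \<in> J X" "i mod a < i' mod a" for i i'
      proof -
        have "transposition a i < transposition a i'" using less that unfolding J_def by blast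
        then have "i \<le> i'" using pos[OF that(1,2)] m by (meson less_imp_le)
        then have "i div a \<le> i' div a" by (rule div_le_mono)
        then show ?thesis using that(3) by simp
      qed
      have "inj_on (\<lambda>i. i div a + i mod a) (J X)"
      proof
        fix i i' assume i: "i \<in> J X" "i' \<in> J X" and eq: "i div a + i mod a = i' div a + i' mod a"
        then have "i mod a = i' mod a" using key[of i i'] key[of i' i] by linarith
        then show "i = i'" using eq by (metis add_right_cancel div_mult_mod_eq)
      qed
      moreover have "(\<lambda>i. i div a + i mod a) ` J X \<subseteq> {..<2 * a}"
      proof
        fix y assume "y \<in> (\<lambda>i. i div a + i mod a) ` J X"
        then obtain i where i: "i < a * a" "y = i div a + i mod a" unfolding J_def by blast
        then have "i div a < a" by (simp add: less_mult_imp_div_less)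
        moreover have "i mod a < a" using \<open>0 < a\<close> by simp
        ultimately show "y \<in> {..<2 * a}" using i(2) by (simp del: mod_less_divisor)
      qed
      ultimately show ?thesis using card_inj_on_le[of _ "J X" "{..<2 * a}"] by fastforce
    next
      assume m: "\<forall>p i p' i'. (p, i) \<in> X \<longrightarrow> (p', i') \<in> X \<longrightarrow> p \<le> p' \<longrightarrow> i' \<le> i"
      have key: "\<not> i div a < i' div a" if "i \<in> J X" "i' \<in> J X" "i mod a = i' mod a" for i i'
      proof
        assume "i div a < i' div a"
        then have "transposition a i < transposition a i'" using less that unfolding J_def by blast
        then have "i' \<le> i" using pos[OF that(1,2)] m by (meson less_imp_le)
        then have "i' div a \<le> i div a" by (rule div_le_mono)
        then show False using \<open>i div a < i' div a\<close> by simp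
      qed
      have "inj_on (\<lambda>i. i mod a) (J X)"
      proof
        fix i i' assume i: "i \<in> J X" "i' \<in> J X" and eq: "i mod a = i' mod a"
        then have "i div a = i' div a" using key[of i i'] key[of i' i] by linarith
        then show "i = i'" using eq by (metis div_mult_mod_eq)
      qed
      moreover have "(\<lambda>i. i mod a) ` J X \<subseteq> {..<2 * a}"
      proof
        fix y assume "y \<in> (\<lambda>i. i mod a) ` J X"
        then have "y < a" using \<open>0 < a\<close> by auto
        then show "y \<in> {..<2 * a}" by simp
      qed
      ultimately show ?thesis using card_inj_on_le[of _ "J X" "{..<2 * a}"] by fastforce
    qed
  qed
  have "card (\<Union>X\<in>\<F>. J X) \<le> (\<Sum>X\<in>\<F>. card (J X))" by (rule card_UN_le[OF F(1)])
  also have "\<dots> \<le> card \<F> * (2 * a)" using sum_bounded_above[of \<F> "\<lambda>X. card (J X)" "2 * a"] cJ by simp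
  also have "\<dots> \<le> K * (2 * a)" using F(2) by simp
  also have "\<dots> < a * a" using K \<open>0 < a\<close> by simp
  finally have "card (\<Union>X\<in>\<F>. J X) < card {..<a * a}" by simp
  then have "\<not> {..<a * a} \<subseteq> (\<Union>X\<in>\<F>. J X)"
    using card_mono[of "\<Union>X\<in>\<F>. J X" "{..<a * a}"] F(1) finJ by fastforce
  then obtain i where i: "i < a * a" "i \<notin> (\<Union>X\<in>\<F>. J X)" by blast
  then show ?thesis using F(4) unfolding J_def by blast
qed

subsection \<open>Prescribing the order of letters in the BWT\<close>

text \<open>With \<open>K\<close> the separator, this splits the suffixes below a given item into
  those below the separator and those that start with it.\<close>

lemma less_append_iff:
  "v < K @ R \<longleftrightarrow> v < K \<or> (\<exists>v'. v = K @ v' \<and> v' < R)" for v K R :: "'b::linorder list"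
proof (induction K arbitrary: v)
  case (Cons k K)
  then show ?case by (cases v) auto
qed simp

lemma append_not_less: "\<not> K @ v < K" for v K :: "'b::linorder list"
  by (induction K) auto

lemma less_by_first_difference:
  fixes xs ys :: "'b::linorder list"
  assumes "k < length xs" "k < length ys" "\<And>i. i < k \<Longrightarrow> xs ! i = ys ! i" "xs ! k < ys ! k"
  shows "xs < ys"
  using assms
proof (induction k arbitrary: xs ys)
  case 0
  then show ?case by (cases xs; cases ys) auto
next
  case (Suc k)
  obtain x xs' y ys' where [simp]: "xs = x # xs'" "ys = y # ys'" using Suc.prems(1,2) by (cases xs; cases ys) auto
  have "x = y" using Suc.prems(3)[of 0] by simp
  moreover have "xs' < ys'" using Suc.prems Suc.prems(3)[of "Suc _"] by (intro Suc.IH) auto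
  ultimately show ?case by simp
qed

lemma sort_key_nth_rank:
  fixes f :: "nat \<Rightarrow> 'b::linorder"
  assumes inj: "inj_on f {..<n}" and i: "i < n"
  shows "sort_key f [0..<n] ! card {i'. i' < n \<and> f i' < f i} = i"
    and "card {i'. i' < n \<and> f i' < f i} < n"
proof -
  define xs where "xs = sort_key f [0..<n]"
  have set: "set xs = {..<n}" and len: "length xs = n" and dist: "distinct xs"
    by (auto simp: xs_def)
  have sorted: "sorted (map f xs)" by (simp add: xs_def)
  obtain q where q: "q < n" "xs ! q = i" using i set len by (metis in_set_conv_nth lessThan_iff)
  have "{i'. i' < n \<and> f i' < f i} = (!) xs ` {..<q}"
  proof (intro equalityI subsetI)
    fix i' assume "i' \<in> {i'. i' < n \<and> f i' < f i}"
    then have i': "i' < n" "f i' < f i" by auto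
    then obtain q' where q': "q' < n" "xs ! q' = i'" using set len by (metis in_set_conv_nth lessThan_iff)
    have "q' < q"
    proof (rule ccontr)
      assume "\<not> q' < q"
      then have "f i \<le> f i'" using sorted_nth_mono[OF sorted, of q q'] q q' len by auto
      then show False using i' by simp
    qed
    then show "i' \<in> (!) xs ` {..<q}" using q' by blast
  next
    fix i' assume "i' \<in> (!) xs ` {..<q}"
    then obtain q' where q': "q' < q" "xs ! q' = i'" by blast
    then have "i' < n" using set len q by (metis lessThan_iff nth_mem order_less_trans)
    moreover have "f i' \<le> f i" using sorted_nth_mono[OF sorted, of q' q] q q' len by auto
    moreover have "i' \<noteq> i" using dist q q' len by (metis nth_eq_iff_index_eq order_less_irrefl order_less_trans)
    ultimately show "i' \<in> {i'. i' < n \<and> f i' < f i}"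
      using inj i by (auto simp: inj_on_def le_less)
  qed
  moreover have "inj_on ((!) xs) {..<q}" using dist len q by (auto simp: inj_on_def nth_eq_iff_index_eq)
  ultimately have "card {i'. i' < n \<and> f i' < f i} = q" by (simp add: card_image)
  then show "sort_key f [0..<n] ! card {i'. i' < n \<and> f i' < f i} = i" "card {i'. i' < n \<and> f i' < f i} < n"
    using q unfolding xs_def by auto
qed

definition marked :: "'a list \<Rightarrow> 'a option list" where
  "marked s = map Some s @ [None]"

text \<open>The string \<open>v\<close> need not be a suffix: the rank of the bare separator is the
  place where the interval of item suffixes begins.\<close>

definition suffix_rank :: "'a::linorder list \<Rightarrow> 'a option list \<Rightarrow> nat" where
  "suffix_rank s v = card {i. i < Suc (length s) \<and> drop i (marked s) < v}"

lemma length_bwt: "length (bwt s) = Suc (length s)"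
  by (simp add: bwt_def Let_def)

lemma bwt_nth:
  assumes "i < length s"
  shows "bwt s ! suffix_rank s (drop (Suc i) (marked s)) = Some (s ! i)"
    and "suffix_rank s (drop (Suc i) (marked s)) < Suc (length s)"
proof -
  define w where "w = marked s"
  have len: "length w = Suc (length s)" by (simp add: w_def marked_def)
  have inj: "inj_on (\<lambda>i. drop i w) {..<Suc (length s)}"
  proof
    fix i i' assume i: "i \<in> {..<Suc (length s)}" "i' \<in> {..<Suc (length s)}" and eq: "drop i w = drop i' w"
    then have "length w - i = length w - i'" by (metis length_drop)
    then show "i = i'" using i len by auto
  qed
  have r: "sort_key (\<lambda>i. drop i w) [0..<Suc (length s)] ! suffix_rank s (drop (Suc i) w) = Suc i"
    "suffix_rank s (drop (Suc i) w) < Suc (length s)"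
    using sort_key_nth_rank[OF inj, of "Suc i"] assms unfolding suffix_rank_def w_def[symmetric] by auto
  have "bwt s ! suffix_rank s (drop (Suc i) w) = w ! i"
    unfolding bwt_def Let_def marked_def[symmetric] w_def[symmetric] len
    using r by (simp del: upt_Suc)
  then show "bwt s ! suffix_rank s (drop (Suc i) (marked s)) = Some (s ! i)"
    "suffix_rank s (drop (Suc i) (marked s)) < Suc (length s)"
    using r assms by (simp_all add: w_def marked_def nth_append)
qed

text \<open>Item \<open>g\<close> of the encoding is a payload letter, the separator \<open>0001\<close>, and the key
  \<open>1\<dots>101\<dots>1\<close> with its \<open>0\<close> at offset \<open>\<rho> g\<close>. The separator occurs nowhere else, so the
  suffixes that start with it form an interval of the suffix order, sorted by \<open>\<rho>\<close>.\<close>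

definition item_letter :: "'a \<Rightarrow> 'a \<Rightarrow> (nat \<Rightarrow> nat) \<Rightarrow> nat set \<Rightarrow> nat \<Rightarrow> nat \<Rightarrow> 'a" where
  "item_letter c0 c1 \<rho> x g u =
     (if u = 0 then (if g \<in> x then c1 else c0)
      else if u = 1 \<or> u = 2 \<or> u = 3 \<or> u = 5 + \<rho> g then c0 else c1)"

definition encoding :: "'a \<Rightarrow> 'a \<Rightarrow> nat \<Rightarrow> (nat \<Rightarrow> nat) \<Rightarrow> nat set \<Rightarrow> 'a list" where
  "encoding c0 c1 G \<rho> x = map (\<lambda>p. item_letter c0 c1 \<rho> x (p div (G + 6)) (p mod (G + 6))) [0..<G * (G + 6)]"

lemma length_encoding [simp]: "length (encoding c0 c1 G \<rho> x) = G * (G + 6)"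
  by (simp add: encoding_def)

lemma encoding_position:
  fixes g u G :: nat
  assumes "g < G" "u < G + 6"
  shows "g * (G + 6) + u < G * (G + 6)"
proof -
  have "g * (G + 6) + u < Suc g * (G + 6)" using assms by simp
  also have "\<dots> \<le> G * (G + 6)" using assms(1) by (intro mult_le_mono1) simp
  finally show ?thesis .
qed

lemma encoding_nth:
  assumes "g < G" "u < G + 6"
  shows "encoding c0 c1 G \<rho> x ! (g * (G + 6) + u) = item_letter c0 c1 \<rho> x g u"
  using encoding_position[OF assms] assms(2) unfolding encoding_def by (simp add: nth_map)

lemma marked_encoding_nth:
  assumes "g < G" "u < G + 6"
  shows "marked (encoding c0 c1 G \<rho> x) ! (g * (G + 6) + u) = Some (item_letter c0 c1 \<rho> x g u)"
  using encoding_position[OF assms] encoding_nth[OF assms] by (simp add: marked_def nth_append)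

context
  fixes c0 c1 :: "'a::linorder" and G :: nat and \<rho> :: "nat \<Rightarrow> nat" and x :: "nat set"
  assumes c: "c0 < c1" and \<rho>: "bij_betw \<rho> {..<G} {..<G}"
begin

private abbreviation "w \<equiv> marked (encoding c0 c1 G \<rho> x)"
private abbreviation "sep \<equiv> map Some [c0, c0, c0, c1]"

private lemma length_w: "length w = Suc (G * (G + 6))"
  by (simp add: marked_def)

private lemma rho_less: "g < G \<Longrightarrow> \<rho> g < G"
  using bij_betwE[OF \<rho>] by auto

private lemma separator_at:
  assumes "g < G"
  shows "\<exists>v. drop (g * (G + 6) + 1) w = sep @ v"
proof -
  have len: "g * (G + 6) + 5 \<le> length w" using encoding_position[OF assms, of 5] by (simp add: length_w)
  have "take 4 (drop (g * (G + 6) + 1) w) = sep"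
  proof (rule nth_equalityI)
    fix i assume "i < length (take 4 (drop (g * (G + 6) + 1) w))"
    then have i: "i < 4" by simp
    then have "take 4 (drop (g * (G + 6) + 1) w) ! i = w ! (g * (G + 6) + (1 + i))"
      using len by (simp add: ac_simps)
    also have "\<dots> = Some (item_letter c0 c1 \<rho> x g (1 + i))"
      using i by (intro marked_encoding_nth[OF assms]) simp
    also have "\<dots> = sep ! i" using i by (auto simp: item_letter_def numeral_eq_Suc less_Suc_eq)
    finally show "take 4 (drop (g * (G + 6) + 1) w) ! i = sep ! i" .
  qed (use len in simp)
  then show ?thesis by (metis append_take_drop_id)
qed

private lemma separator_only:
  assumes "i < Suc (G * (G + 6))" "drop i w = sep @ v"
  shows "\<exists>g<G. i = g * (G + 6) + 1"
proof -
  have at: "w ! (i + q) = sep ! q" if "q < 4" for q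
  proof -
    have "length (drop i w) = 4 + length v" using assms(2) by simp
    then have "i + q < length w" using that by simp
    then have "w ! (i + q) = drop i w ! q" by simp
    also have "\<dots> = sep ! q" unfolding assms(2) using that by (simp only: nth_append) simp
    finally show ?thesis .
  qed
  have "w ! i = Some c0" "w ! (i + 1) = Some c0" "w ! (i + 2) = Some c0" "w ! (i + 3) = Some c1"
    using at[of 0] at[of 1] at[of 2] at[of 3] by (auto simp: numeral_eq_Suc)
  note at = this
  have "w ! (G * (G + 6)) = None" by (simp add: marked_def nth_append)
  then have "i < G * (G + 6)" using at(1) assms(1) by (cases "i = G * (G + 6)") auto
  define g u where "g = i div (G + 6)" and "u = i mod (G + 6)"
  have i: "i = g * (G + 6) + u" unfolding g_def u_def by (simp only: div_mult_mod_eq)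
  have g: "g < G" using \<open>i < G * (G + 6)\<close> unfolding g_def by (rule less_mult_imp_div_less)
  have u: "u < G + 6" by (simp add: u_def)
  have letter: "w ! (i + q) = Some (item_letter c0 c1 \<rho> x g (u + q))" if "u + q < G + 6" for q
    using marked_encoding_nth[OF g that] i by (simp add: add.assoc)
  have "u = 1"
  proof (rule ccontr)
    assume "u \<noteq> 1"
    then consider "u = 0" | "u = 2" | "u = 3" | "u = 4" | "5 \<le> u" by linarith
    then show False
    proof cases
      case 1 then show False using letter[of 3] at c by (simp add: item_letter_def)
    next
      case 2 then show False using letter[of 2] at c by (simp add: item_letter_def)
    next
      case 3 then show False using letter[of 1] at c by (simp add: item_letter_def)
    next
      case 4 then show False using letter[of 0] at c by (simp add: item_letter_def)
    next
      \<comment> \<open>Within the key only its single \<open>c0\<close> could start a separator.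
        Since \<open>\<rho> g < G\<close>, the item has a \<open>c1\<close> right after it, so this
        zero never joins letters of the next item.\<close>
      case 5
      then have "u = 5 + \<rho> g" using letter[of 0] u at c by (auto simp: item_letter_def split: if_splits)
      then show False using letter[of 1] rho_less[OF g] at c by (simp add: item_letter_def)
    qed
  qed
  then show ?thesis using g i by blast
qed

text \<open>The first difference is at the \<open>c0\<close> of the key with the smaller
  \<open>\<rho>\<close>. It lies inside the item, so no payload letter is ever compared and the
  order does not depend on \<open>x\<close>.\<close>

private lemma suffix_less:
  assumes "g < G" "g' < G" "\<rho> g' < \<rho> g"
  shows "drop (g' * (G + 6) + 1) w < drop (g * (G + 6) + 1) w"
proof (rule less_by_first_difference)
  have l: "drop (h * (G + 6) + 1) w ! i = Some (item_letter c0 c1 \<rho> x h (1 + i))"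
      "i < length (drop (h * (G + 6) + 1) w)" if "h < G" "1 + i < G + 6" for h i
  proof -
    have "h * (G + 6) + (1 + i) < length w" using encoding_position[OF that] by (simp add: length_w)
    then show "i < length (drop (h * (G + 6) + 1) w)"
      "drop (h * (G + 6) + 1) w ! i = Some (item_letter c0 c1 \<rho> x h (1 + i))"
      using marked_encoding_nth[OF that, of c0 c1 \<rho> x] by (simp_all add: add.assoc)
  qed
  have k: "1 + (4 + \<rho> g') < G + 6" using rho_less[OF assms(2)] by simp
  show "4 + \<rho> g' < length (drop (g' * (G + 6) + 1) w)" "4 + \<rho> g' < length (drop (g * (G + 6) + 1) w)"
    using l(2)[OF assms(2) k] l(2)[OF assms(1) k] by auto
  show "drop (g' * (G + 6) + 1) w ! (4 + \<rho> g') < drop (g * (G + 6) + 1) w ! (4 + \<rho> g')"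
    using l(1)[OF assms(2) k] l(1)[OF assms(1) k] assms(3) c by (simp add: item_letter_def)
  show "drop (g' * (G + 6) + 1) w ! i = drop (g * (G + 6) + 1) w ! i" if "i < 4 + \<rho> g'" for i
  proof -
    have i: "1 + i < G + 6" using that k by simp
    show ?thesis using l(1)[OF assms(2) i] l(1)[OF assms(1) i] that assms(3) by (simp add: item_letter_def)
  qed
qed

text \<open>Below the suffix of item \<open>g\<close> are the suffixes below the separator and the
  suffixes of items with a smaller value of \<open>\<rho>\<close>; as \<open>\<rho>\<close> permutes
  \<open>{..<G}\<close>, the latter number \<open>\<rho> g\<close>.\<close>

lemma suffix_rank_item:
  assumes g: "g < G"
  shows "suffix_rank (encoding c0 c1 G \<rho> x) (drop (g * (G + 6) + 1) w) =
    suffix_rank (encoding c0 c1 G \<rho> x) sep + \<rho> g"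
proof -
  let ?n = "G * (G + 6)" and ?S = "\<lambda>g. drop (g * (G + 6) + 1) w"
  define below where "below = {i. i < Suc ?n \<and> drop i w < sep}"
  define before where "before = {h. h < G \<and> \<rho> h < \<rho> g}"
  have iff: "?S h < ?S g \<longleftrightarrow> \<rho> h < \<rho> g" if "h < G" for h
  proof -
    have "\<rho> h = \<rho> g \<Longrightarrow> h = g" using \<rho> that g by (auto simp: bij_betw_def inj_on_def)
    then show ?thesis using suffix_less[OF g that] suffix_less[OF that g] by (metis less_asym linorder_neqE_nat)
  qed
  have "{i. i < Suc ?n \<and> drop i w < ?S g} = below \<union> (\<lambda>h. h * (G + 6) + 1) ` before"
  proof (intro equalityI subsetI)
    fix i assume "i \<in> {i. i < Suc ?n \<and> drop i w < ?S g}"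
    then have i: "i < Suc ?n" "drop i w < ?S g" by auto
    obtain R where "?S g = sep @ R" using separator_at[OF g] by blast
    with i(2) consider "drop i w < sep" | v where "drop i w = sep @ v" by (auto simp: less_append_iff simp del: list.map)
    then show "i \<in> below \<union> (\<lambda>h. h * (G + 6) + 1) ` before"
    proof cases
      case 1
      then show ?thesis using i by (simp add: below_def)
    next
      case 2
      then obtain h where h: "h < G" "i = h * (G + 6) + 1" using separator_only[OF i(1)] by blast
      then have "h \<in> before" using iff i by (simp add: before_def)
      then show ?thesis using h by blast
    qed
  next
    fix i assume "i \<in> below \<union> (\<lambda>h. h * (G + 6) + 1) ` before"
    then show "i \<in> {i. i < Suc ?n \<and> drop i w < ?S g}"
    proof
      assume i: "i \<in> below"
      obtain R where "?S g = sep @ R" using separator_at[OF g] by blast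
      then show ?thesis using i by (auto simp: below_def less_append_iff simp del: list.map)
    next
      assume "i \<in> (\<lambda>h. h * (G + 6) + 1) ` before"
      then obtain h where h: "h < G" "\<rho> h < \<rho> g" "i = h * (G + 6) + 1" by (auto simp: before_def)
      then show ?thesis using iff[OF h(1)] encoding_position[OF h(1), of 1] by simp
    qed
  qed
  moreover have "below \<inter> (\<lambda>h. h * (G + 6) + 1) ` before = {}"
  proof (rule ccontr)
    assume "\<not> ?thesis"
    then obtain h where h: "h < G" "?S h < sep" unfolding below_def before_def by blast
    then show False using separator_at[OF h(1)] append_not_less[of sep] by metis
  qed
  moreover have "finite below" "finite before" by (simp_all add: below_def before_def)
  moreover have "inj_on (\<lambda>h. h * (G + 6) + 1) before" by (rule inj_onI) simp
  ultimately have card: "suffix_rank (encoding c0 c1 G \<rho> x) (?S g) = card below + card before"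
    unfolding suffix_rank_def by (simp add: card_Un_disjoint card_image)
  have "\<rho> ` before = {..<\<rho> g}"
  proof (intro equalityI subsetI)
    fix k assume "k \<in> {..<\<rho> g}"
    then have "k < \<rho> g" "k \<in> \<rho> ` {..<G}" using \<rho> rho_less[OF g] by (auto simp: bij_betw_def)
    then show "k \<in> \<rho> ` before" unfolding before_def by auto
  qed (auto simp: before_def)
  moreover have "inj_on \<rho> before" by (rule inj_on_subset[of _ "{..<G}"]) (use \<rho> in \<open>auto simp: bij_betw_def before_def\<close>)
  ultimately have "card before = \<rho> g" by (metis card_image card_lessThan)
  then show ?thesis using card by (simp add: suffix_rank_def below_def)
qed

lemma bwt_encoding:
  assumes g: "g < G"
  shows "bwt (encoding c0 c1 G \<rho> x) ! (suffix_rank (encoding c0 c1 G \<rho> x) sep + \<rho> g) =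
      Some (if g \<in> x then c1 else c0)"
    and "suffix_rank (encoding c0 c1 G \<rho> x) sep + \<rho> g < Suc (G * (G + 6))"
proof -
  have u: "0 < G + 6" by simp
  have "g * (G + 6) < length (encoding c0 c1 G \<rho> x)" using encoding_position[OF g u] by simp
  from bwt_nth[OF this]
  show "bwt (encoding c0 c1 G \<rho> x) ! (suffix_rank (encoding c0 c1 G \<rho> x) sep + \<rho> g) =
      Some (if g \<in> x then c1 else c0)"
    "suffix_rank (encoding c0 c1 G \<rho> x) sep + \<rho> g < Suc (G * (G + 6))"
    using suffix_rank_item[OF g] encoding_nth[OF g u, of c0 c1 \<rho> x] by (simp_all add: item_letter_def)
qed

end

subsection \<open>Counting traces against inputs\<close>

lemma transposition_involution:
  assumes "i < a * a"
  shows "transposition a (transposition a i) = i" "transposition a i < a * a"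
proof -
  have a: "0 < a" using assms by (cases a) auto
  have d: "i div a < a" using assms by (simp add: less_mult_imp_div_less)
  then show "transposition a (transposition a i) = i" by (simp add: transposition_def)
  have "i mod a * a + i div a < Suc (i mod a) * a" using d by simp
  also have "\<dots> \<le> a * a" using a by (intro mult_le_mono1) (simp add: Suc_leI)
  finally show "transposition a i < a * a" by (simp add: transposition_def)
qed

text \<open>Whole blocks are permuted and the order within a block is kept, so each block goes to an
  interval of the output.\<close>

definition item_rank :: "nat \<Rightarrow> nat \<Rightarrow> nat \<Rightarrow> nat" where
  "item_rank a L g = transposition a (g div L) * L + g mod L"

lemma bij_item_rank:
  assumes "0 < L"
  shows "bij_betw (item_rank a L) {..<a * a * L} {..<a * a * L}"
proof (rule bij_betw_byWitness[where f' = "item_rank a L"])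
  have div: "item_rank a L g div L = transposition a (g div L)" for g
    using assms by (simp add: item_rank_def)
  have "item_rank a L (item_rank a L g) = g" if "g < a * a * L" for g
  proof -
    have "g div L < a * a" using that by (rule less_mult_imp_div_less)
    then have "transposition a (transposition a (g div L)) = g div L" by (rule transposition_involution)
    then show ?thesis unfolding item_rank_def[of a L "item_rank a L g"] div by (simp add: item_rank_def)
  qed
  then show "\<forall>g\<in>{..<a * a * L}. item_rank a L (item_rank a L g) = g"
    "\<forall>g\<in>{..<a * a * L}. item_rank a L (item_rank a L g) = g" by auto
  have "item_rank a L g < a * a * L" if "g < a * a * L" for g
  proof -
    have "transposition a (g div L) < a * a"
      using that by (intro transposition_involution(2) less_mult_imp_div_less)
    then have "Suc (transposition a (g div L)) * L \<le> a * a * L" by (intro mult_le_mono1) simp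
    then show ?thesis using mod_less_divisor[OF assms, of g] by (simp add: item_rank_def)
  qed
  then show "item_rank a L ` {..<a * a * L} \<subseteq> {..<a * a * L}"
    "item_rank a L ` {..<a * a * L} \<subseteq> {..<a * a * L}" by auto
qed

lemma encoding_agree:
  assumes agree: "\<And>g. g div L \<noteq> i \<Longrightarrow> g \<in> x \<longleftrightarrow> g \<in> y"
    and "i \<notin> block_tag (q * (L * (G + 6))) (L * (G + 6)) j p" "G = q * L"
  shows "stream (initial_config A (encoding c0 c1 G \<rho> x)) j p =
    stream (initial_config A (encoding c0 c1 G \<rho> y)) j p"
proof (cases "j = 0 \<and> p < G * (G + 6)")
  case True
  then have "p div (G + 6) div L \<noteq> i"
    using assms(2,3) by (simp add: block_tag_def mult.assoc div_mult2_eq[symmetric] mult.commute[of L])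
  then have "p div (G + 6) \<in> x \<longleftrightarrow> p div (G + 6) \<in> y" using agree by blast
  then show ?thesis using True
    by (simp add: initial_config_def stream_of_def encoding_def item_letter_def)
qed (auto simp: initial_config_def stream_of_def)

lemma final_stream:
  assumes "computes A f" "halted A (config_after A s N)"
  shows "stream (config_after A s N) (output_stream A) = stream_of (f s)"
proof -
  obtain k where k: "halted A (config_after A s k)"
    "stream (config_after A s k) (output_stream A) = stream_of (f s)"
    using assms(1) unfolding computes_def by blast
  have "config_after A s N = config_after A s k"
    using config_after_halted[OF k(1), of "max k N"] config_after_halted[OF assms(2), of "max k N"] by simp
  then show ?thesis using k(2) by simp
qed

text \<open>Inputs with equal traces, and equally many suffixes below the separator, differ in no single
  block that the output region of that block does not depend on; hence such a class has at most
  \<open>2 ^ (G - L)\<close> members.\<close>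

lemma counting_bound:
  fixes A :: "('a::{finite, linorder}, 'g::finite) rw_algorithm" and c0 c1 :: 'a and a :: nat
  assumes c: "c0 < c1" and mem: "uses_memory A m" and passes: "uses_passes A r"
    and comp: "computes A bwt"
  defines "L \<equiv> a ^ 3"
  defines "n \<equiv> a ^ 5 * (a ^ 5 + 6)"
  defines "t \<equiv> num_streams A"
  defines "K \<equiv> (2 * t + 2) ^ (r n + 1)"
  defines "Q \<equiv> view_bound (card (UNIV :: ('a, 'g) cell set)) t (m n)"
  defines "N \<equiv> (n + 2) * (1 + (t + 1) * (Q + 1)) ^ (r n + 1)"
  assumes K: "2 * K < a"
  shows "2 ^ L \<le> (n + 2) * ((N + 1) ^ (t + 1) * Q + 1) ^ (K * (a * a + 2 * t + 3) + 1)"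
proof -
  define q where "q = a * a"
  define G where "G = a ^ 5"
  define b where "b = L * (G + 6)"
  define s where "s x = encoding c0 c1 G (item_rank a L) x" for x
  define d where "d x = suffix_rank (s x) (map Some [c0, c0, c0, c1])" for x
  define T where "T x = trace A (block_tag (q * b) b) (s x) N" for x
  define D where "D x = run_tag A (block_tag (q * b) b) (s x) N (output_stream A)" for x
  define X where "X = Pow {..<G}"
  \<comment> \<open>The offset of the item interval depends on \<open>x\<close>, because a payload
    letter \<open>c0\<close> followed by a separator begins a suffix below the separator. Fixing it
    costs only a factor \<open>n + 2\<close> in the number of classes.\<close>
  define cls where "cls x = (T x, d x)" for x
  have "0 < a" using K by simp
  then have L: "0 < L" and b: "0 < b" by (simp_all add: L_def b_def)
  have GL: "G = q * L" by (simp add: G_def q_def L_def eval_nat_numeral)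
  have nG: "n = G * (G + 6)" by (simp add: n_def G_def)
  have rho: "bij_betw (item_rank a L) {..<G} {..<G}" using bij_item_rank[OF L, of a] GL q_def by simp
  have out: "output_stream A < t" using comp by (simp add: computes_def t_def)
  have len: "length (s x) = n" for x by (simp add: s_def nG)
  have mem': "length (memory (config_after A (s x) k)) \<le> m n" for x k
    using mem len[of x] unfolding uses_memory_def by metis
  have passes': "total_passes A (config_after A (s x) k) \<le> r n" for x k
    using passes len[of x] unfolding uses_passes_def total_passes_def by metis
  have halts: "\<exists>k. halted A (config_after A (s x) k)" for x using comp unfolding computes_def by blast
  have haltN: "halted A (config_after A (s x) N)" for x
    using halts[of x] running_time[OF mem' _ passes', of x _ Q] len[of x] unfolding N_def Q_def t_def by auto
  have "0 < N" by (simp add: N_def)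
  have result: "stream (config_after A (s x) N) (output_stream A) = stream_of (bwt (s x))" for x
    by (rule final_stream[OF comp haltN])
  \<comment> \<open>The block \<open>i\<close> is found from the tags of the one member
    \<open>x0\<close>. Equal traces give equal tags, so its output region is free of tag
    \<open>i\<close> for every member, and all of block \<open>i\<close> can be recovered from the
    rest.\<close>
  have class_card: "card {x \<in> X. cls x = cls x0} \<le> 2 ^ (G - L)" if "x0 \<in> X" for x0
  proof -
    have "chain_cover K (D x0)"
      unfolding D_def K_def t_def by (rule run_structure(1)[OF passes' b]) (use out in \<open>simp add: t_def\<close>)
    then obtain i where i: "i < a * a" and
      untouched: "\<And>p. d x0 + transposition a i * L \<le> p \<Longrightarrow> p < d x0 + transposition a i * L + L \<Longrightarrow> i \<notin> D x0 p"
      using untouched_block[OF _ K] by blast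
    define B where "B = {i * L..<i * L + L}"
    have B_iff: "g \<in> B \<longleftrightarrow> g div L = i" for g
    proof
      assume "g \<in> B"
      then show "g div L = i" by (intro div_nat_eqI) (auto simp: B_def mult.commute)
    next
      assume "g div L = i"
      then have "i * L + g mod L = g" by auto
      moreover have "g mod L < L" using L by simp
      ultimately show "g \<in> B" unfolding B_def by (metis atLeastLessThan_iff le_add1 nat_add_left_cancel_less)
    qed
    have "Suc i * L \<le> q * L" using i by (intro mult_le_mono1) (simp add: q_def)
    then have BG: "B \<subseteq> {..<G}" unfolding B_def GL by auto
    have "inj_on (\<lambda>x. x - B) {x \<in> X. cls x = cls x0}"
    proof
      fix x y assume x: "x \<in> {x \<in> X. cls x = cls x0}" and y: "y \<in> {x \<in> X. cls x = cls x0}"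
        and eq: "x - B = y - B"
      have agree: "g \<in> x \<longleftrightarrow> g \<in> y" if "g div L \<noteq> i" for g using eq that B_iff by blast
      have Txy: "trace A (block_tag (q * b) b) (s x) N = trace A (block_tag (q * b) b) (s y) N"
        and Tx0: "trace A (block_tag (q * b) b) (s x) N = trace A (block_tag (q * b) b) (s x0) N"
        and dx: "d x = d x0" and dy: "d y = d x0"
        using x y by (auto simp: cls_def T_def)
      have init: "stream (initial_config A (s x)) j p = stream (initial_config A (s y)) j p"
        if "i \<notin> block_tag (q * b) b j p" for j p
        unfolding s_def by (rule encoding_agree[OF agree _ GL]) (use that in \<open>simp_all add: b_def\<close>)
      have "g \<in> x \<longleftrightarrow> g \<in> y" if g: "g \<in> B" for g
      proof -
        have gG: "g < G" using g BG by auto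
        define p where "p = d x0 + item_rank a L g"
        have "g mod L < L" using L by simp
        then have "i \<notin> D x0 p"
          using g unfolding B_iff p_def item_rank_def by (intro untouched) auto
        then have "i \<notin> D x p"
          using trace_determines(1)[OF Tx0 \<open>0 < N\<close>, of "output_stream A" p] out unfolding D_def t_def by simp
        then have "stream (config_after A (s x) N) (output_stream A) p = stream (config_after A (s y) N) (output_stream A) p"
          using out unfolding D_def t_def by (intro trace_determines(2)[OF Txy \<open>0 < N\<close> init])
        then have "stream_of (bwt (s x)) p = (stream_of (bwt (s y)) p :: ('a, 'g) cell)"
          by (simp only: result)
        moreover have "stream_of (bwt (s z)) p = (Sym (Some (if g \<in> z then c1 else c0)) :: ('a, 'g) cell)"
          if "d z = d x0" for z
          using bwt_encoding[OF c rho gG, of z] that length_bwt[of "s z"] len[of z]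
          unfolding stream_of_def p_def d_def s_def nG by simp
        ultimately show ?thesis using dx dy c by (auto split: if_splits)
      qed
      then show "x = y" using agree B_iff by blast
    qed
    moreover have "(\<lambda>x. x - B) ` {x \<in> X. cls x = cls x0} \<subseteq> Pow ({..<G} - B)" by (auto simp: X_def)
    ultimately have "card {x \<in> X. cls x = cls x0} \<le> card (Pow ({..<G} - B))"
      by (intro card_inj_on_le) simp_all
    also have "\<dots> = 2 ^ (G - L)"
      using BG by (simp add: card_Pow card_Diff_subset finite_subset[OF BG]) (simp add: B_def)
    finally show ?thesis .
  qed
  define e where "e = K * (a * a + 2 * t + 3)"
  define M where "M = (N + 1) ^ (t + 1) * Q"
  have traces: "finite ((\<lambda>s. trace A (block_tag (q * b) b) s N) ` s ` X)"
    "card ((\<lambda>s. trace A (block_tag (q * b) b) s N) ` s ` X) \<le> (M + 1) ^ (e + 1)"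
  proof -
    have ev: "card (run_events A (block_tag (q * b) b) s' N) \<le> e" if "s' \<in> s ` X" for s'
      using that run_structure(2)[OF passes' b] unfolding e_def K_def t_def q_def by auto
    have "length (memory (config_after A s' k)) \<le> m n" if "s' \<in> s ` X" for s' k
      using that mem' by auto
    from card_traces[OF this ev]
    show "finite ((\<lambda>s. trace A (block_tag (q * b) b) s N) ` s ` X)"
      "card ((\<lambda>s. trace A (block_tag (q * b) b) s N) ` s ` X) \<le> (M + 1) ^ (e + 1)"
      unfolding M_def Q_def t_def by blast+
  qed
  have "d x \<le> Suc n" for x
  proof -
    have "d x \<le> card {..<Suc n}" unfolding d_def suffix_rank_def len by (intro card_mono) auto
    then show ?thesis by simp
  qed
  then have "cls ` X \<subseteq> ((\<lambda>s. trace A (block_tag (q * b) b) s N) ` s ` X) \<times> {..Suc n}"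
    by (auto simp: cls_def T_def)
  then have "card (cls ` X) \<le> card (((\<lambda>s. trace A (block_tag (q * b) b) s N) ` s ` X) \<times> {..Suc n})"
    using traces(1) by (intro card_mono) auto
  also have "\<dots> \<le> (M + 1) ^ (e + 1) * (n + 2)"
    unfolding card_cartesian_product by (intro mult_le_mono traces(2)) simp
  finally have classes: "card (cls ` X) \<le> (M + 1) ^ (e + 1) * (n + 2)" .
  have "L \<le> G" using GL \<open>0 < a\<close> by (simp add: q_def)
  have finX: "finite X" by (simp add: X_def)
  have "2 ^ L * 2 ^ (G - L) = (2::nat) ^ G" using \<open>L \<le> G\<close> by (simp add: power_add[symmetric])
  also have "\<dots> = card X" by (simp add: X_def card_Pow)
  also have "\<dots> = card (\<Union>\<kappa>\<in>cls ` X. {x \<in> X. cls x = \<kappa>})" by (rule arg_cong[of _ _ card]) auto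
  also have "\<dots> \<le> (\<Sum>\<kappa>\<in>cls ` X. card {x \<in> X. cls x = \<kappa>})" using finX by (intro card_UN_le) simp
  also have "\<dots> \<le> (\<Sum>\<kappa>\<in>cls ` X. 2 ^ (G - L))" by (rule sum_mono) (use class_card in auto)
  also have "\<dots> = card (cls ` X) * 2 ^ (G - L)" by simp
  finally have "2 ^ L \<le> card (cls ` X)" by simp
  also note classes
  finally show ?thesis unfolding M_def e_def by (simp only: mult.commute)
qed

section \<open>Asymptotic estimates\<close>

lemma counting_bound_ln:
  fixes n t Q N L e :: nat
  assumes "0 < Q"
    and "2 ^ L \<le> (n + 2) * ((N + 1) ^ (t + 1) * Q + 1) ^ e"
  shows "real L * ln 2 \<le> ln (real n + 2) + real e * (ln 2 + (real t + 1) * ln (real N + 1) + ln (real Q))"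
proof -
  define M where "M = (N + 1) ^ (t + 1) * Q"
  have "1 \<le> M" using assms(1) unfolding M_def by (simp add: Suc_le_eq)
  have "real (2 ^ L) \<le> real ((n + 2) * (M + 1) ^ e)" using assms(2) unfolding M_def of_nat_le_iff .
  then have "2 ^ L \<le> (real n + 2) * (real M + 1) ^ e" by (simp add: algebra_simps)
  moreover have "0 < (real n + 2) * (real M + 1) ^ e" by (intro mult_pos_pos zero_less_power) auto
  ultimately have "ln (2 ^ L) \<le> ln ((real n + 2) * (real M + 1) ^ e)" by (subst ln_le_cancel_iff) auto
  then have "real L * ln 2 \<le> ln (real n + 2) + real e * ln (real M + 1)"
    by (simp add: ln_mult ln_realpow add_pos_nonneg)
  moreover have "ln (real M + 1) \<le> ln 2 + (real t + 1) * ln (real N + 1) + ln (real Q)"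
  proof -
    have "ln (real M + 1) \<le> ln (2 * ((real N + 1) ^ (t + 1) * real Q))"
    proof (subst ln_le_cancel_iff)
      have "real M + 1 \<le> 2 * real M" using \<open>1 \<le> M\<close> by simp
      also have "\<dots> = 2 * ((real N + 1) ^ (t + 1) * real Q)" by (simp add: M_def algebra_simps)
      finally show "real M + 1 \<le> 2 * ((real N + 1) ^ (t + 1) * real Q)" .
    qed (use assms(1) in \<open>auto simp: add_pos_nonneg\<close>)
    also have "\<dots> = ln 2 + ((real t + 1) * ln (real N + 1) + ln (real Q))"
    proof -
      define P where "P = (real N + 1) ^ (t + 1)"
      have "0 < P" unfolding P_def by (intro zero_less_power) simp
      moreover have "ln P = (real t + 1) * ln (real N + 1)"
        unfolding P_def by (subst ln_realpow) (simp_all add: ac_simps)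
      ultimately show ?thesis unfolding P_def[symmetric] using assms(1) by (simp add: ln_mult)
    qed
    finally show ?thesis by simp
  qed
  then have "real e * ln (real M + 1) \<le> real e * (ln 2 + (real t + 1) * ln (real N + 1) + ln (real Q))"
    by (rule mult_left_mono) simp
  ultimately show ?thesis by linarith
qed

lemma ln_time_bound:
  fixes n t Q R :: nat
  assumes "0 < Q"
  shows "ln (real ((n + 2) * (1 + (t + 1) * (Q + 1)) ^ R) + 1) \<le>
    ln 2 + ln (real n + 2) + real R * (ln (2 * real t + 3) + ln (real Q))"
proof -
  define Z where "Z = 1 + (t + 1) * (Q + 1)"
  have "1 \<le> (n + 2) * Z ^ R" by (simp add: Z_def Suc_le_eq)
  then have "real ((n + 2) * Z ^ R) + 1 \<le> 2 * real ((n + 2) * Z ^ R)" by linarith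
  also have "\<dots> = 2 * ((real n + 2) * real Z ^ R)" by (simp add: algebra_simps)
  finally have "ln (real ((n + 2) * Z ^ R) + 1) \<le> ln (2 * ((real n + 2) * real Z ^ R))"
    by (subst ln_le_cancel_iff) (auto simp: Z_def add_pos_nonneg)
  also have "\<dots> = ln 2 + (ln (real n + 2) + real R * ln (real Z))"
  proof -
    have "0 < Z" by (simp add: Z_def)
    then have "0 < real Z" by simp
    then show ?thesis by (simp add: ln_mult ln_realpow add_pos_nonneg)
  qed
  also have "real R * ln (real Z) \<le> real R * (ln (2 * real t + 3) + ln (real Q))"
  proof (rule mult_left_mono)
    have "Z \<le> (2 * t + 3) * Q" using assms by (cases Q) (auto simp: Z_def algebra_simps)
    then have "real Z \<le> real ((2 * t + 3) * Q)" by (rule of_nat_mono)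
    then have "real Z \<le> (2 * real t + 3) * real Q" by simp
    then have "ln (real Z) \<le> ln ((2 * real t + 3) * real Q)"
      using assms by (subst ln_le_cancel_iff) (auto simp: Z_def add_pos_nonneg)
    then show "ln (real Z) \<le> ln (2 * real t + 3) + ln (real Q)"
      using assms by (simp add: ln_mult add_pos_nonneg)
  qed simp
  finally show ?thesis unfolding Z_def by simp
qed

lemma eventually_polylog_memory:
  fixes m :: "nat \<Rightarrow> nat"
  assumes "(\<lambda>n. real (m n)) \<in> O(\<lambda>n. ln (real n) ^ c)"
  shows "eventually (\<lambda>a. real (m (a ^ 5 * (a ^ 5 + 6))) + 1 \<le> real a powr (1 / 8)) at_top"
proof -
  obtain C where C: "C > 0" "eventually (\<lambda>n. real (m n) \<le> C * \<bar>ln (real n) ^ c\<bar>) at_top"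
    using assms by (elim landau_o.bigE) auto
  have lim: "filterlim (\<lambda>a::nat. a ^ 5 * (a ^ 5 + 6)) at_top at_top" by real_asymp
  have 1: "eventually (\<lambda>a. real (m (a ^ 5 * (a ^ 5 + 6))) \<le> C * \<bar>ln (real (a ^ 5 * (a ^ 5 + 6))) ^ c\<bar>) at_top"
    using eventually_compose_filterlim[OF C(2) lim] .
  \<comment> \<open>The input length has degree 10 in \<open>a\<close>; the constant 11 leaves room
    for the lower-order term.\<close>
  have 2: "eventually (\<lambda>a::nat. ln (real (a ^ 5 * (a ^ 5 + 6))) \<le> 11 * ln (real a)) at_top" by real_asymp
  have 3: "eventually (\<lambda>a::nat. C * (11 * ln (real a)) ^ c + 1 \<le> real a powr (1 / 8)) at_top"
    using C(1) by real_asymp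
  show ?thesis using 1 2 3 eventually_ge_at_top[of 1]
  proof eventually_elim
    case (elim a)
    have ge: "1 \<le> real (a ^ 5 * (a ^ 5 + 6))" using elim(4) by (simp add: Suc_le_eq del: of_nat_mult of_nat_add)
    then have "0 \<le> ln (real (a ^ 5 * (a ^ 5 + 6)))" by (rule ln_ge_zero)
    then have "\<bar>ln (real (a ^ 5 * (a ^ 5 + 6))) ^ c\<bar> \<le> (11 * ln (real a)) ^ c"
      using power_mono[OF elim(2), of c] by simp
    then have "C * \<bar>ln (real (a ^ 5 * (a ^ 5 + 6))) ^ c\<bar> \<le> C * (11 * ln (real a)) ^ c"
      using C(1) by simp
    then show ?case using elim(1,3) by linarith
  qed
qed

lemma eventually_few_passes:
  fixes r :: "nat \<Rightarrow> nat"
  assumes "(\<lambda>n. real (r n)) \<in> o(\<lambda>n. ln (real n))" "1 < B"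
  shows "eventually (\<lambda>a. real (r (a ^ 5 * (a ^ 5 + 6)) + 1) * ln B \<le> ln (real a) / 4) at_top"
proof -
  \<comment> \<open>Here 48 is 4 times 12: a factor 11 from \<open>ln n \<le> 11 * ln a\<close>, one
    more for the added pass, and 4 for the quarter of \<open>ln a\<close> aimed at.\<close>
  define \<delta> where "\<delta> = 1 / (48 * ln B)"
  have \<delta>: "0 < \<delta>" using assms(2) by (simp add: \<delta>_def)
  have lim: "filterlim (\<lambda>a::nat. a ^ 5 * (a ^ 5 + 6)) at_top at_top" by real_asymp
  have "eventually (\<lambda>n. real (r n) \<le> \<delta> * \<bar>ln (real n)\<bar>) at_top"
    using landau_o.smallD[OF assms(1) \<delta>] by simp
  from eventually_compose_filterlim[OF this lim]
  have 1: "eventually (\<lambda>a. real (r (a ^ 5 * (a ^ 5 + 6))) \<le> \<delta> * \<bar>ln (real (a ^ 5 * (a ^ 5 + 6)))\<bar>) at_top" .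
  have 2: "eventually (\<lambda>a::nat. ln (real (a ^ 5 * (a ^ 5 + 6))) \<le> 11 * ln (real a)) at_top" by real_asymp
  have 3: "eventually (\<lambda>a::nat. 1 \<le> \<delta> * ln (real a)) at_top" using \<delta> by real_asymp
  show ?thesis using 1 2 3 eventually_ge_at_top[of 1]
  proof eventually_elim
    case (elim a)
    have ge: "1 \<le> real (a ^ 5 * (a ^ 5 + 6))" using elim(4) by (simp add: Suc_le_eq del: of_nat_mult of_nat_add)
    then have "0 \<le> ln (real (a ^ 5 * (a ^ 5 + 6)))" by (rule ln_ge_zero)
    then have "\<delta> * \<bar>ln (real (a ^ 5 * (a ^ 5 + 6)))\<bar> \<le> \<delta> * (11 * ln (real a))"
      using elim(2) \<delta> by simp
    then have "real (r (a ^ 5 * (a ^ 5 + 6)) + 1) \<le> 12 * \<delta> * ln (real a)" using elim(1,3) by simp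
    then have "real (r (a ^ 5 * (a ^ 5 + 6)) + 1) * ln B \<le> 12 * \<delta> * ln (real a) * ln B"
      using assms(2) by (intro mult_right_mono) auto
    also have "\<dots> = ln (real a) / 4" using assms(2) by (simp add: \<delta>_def field_simps)
    finally show ?case .
  qed
qed

theorem theorem12:
  assumes "card (UNIV :: 'a::{finite, linorder} set) \<ge> 2"
  shows "\<not> (\<exists>(A :: ('a, 'g::finite) rw_algorithm) (m :: nat \<Rightarrow> nat) (r :: nat \<Rightarrow> nat) (c :: nat).
    uses_memory A m \<and> (\<lambda>n. real (m n)) \<in> O(\<lambda>n. ln (real n) ^ c) \<and>
    uses_passes A r \<and> (\<lambda>n. real (r n)) \<in> o(\<lambda>n. ln (real n)) \<and>
    computes A bwt)"
proof
  assume "\<exists>(A :: ('a, 'g::finite) rw_algorithm) (m :: nat \<Rightarrow> nat) (r :: nat \<Rightarrow> nat) (c :: nat).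
    uses_memory A m \<and> (\<lambda>n. real (m n)) \<in> O(\<lambda>n. ln (real n) ^ c) \<and>
    uses_passes A r \<and> (\<lambda>n. real (r n)) \<in> o(\<lambda>n. ln (real n)) \<and>
    computes A bwt"
  then obtain A :: "('a, 'g) rw_algorithm" and m r :: "nat \<Rightarrow> nat" and c :: nat where
    mem: "uses_memory A m" and m: "(\<lambda>n. real (m n)) \<in> O(\<lambda>n. ln (real n) ^ c)" and
    passes: "uses_passes A r" and r: "(\<lambda>n. real (r n)) \<in> o(\<lambda>n. ln (real n))" and
    comp: "computes A bwt" by blast
  obtain c0 c1 :: 'a where c: "c0 < c1"
  proof -
    have "\<not> (\<forall>x y :: 'a. x = y)"
    proof
      assume "\<forall>x y :: 'a. x = y"
      then have "card (UNIV :: 'a set) \<le> Suc 0" by (intro card_le_Suc0_iff_eq[THEN iffD2]) auto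
      then show False using assms by simp
    qed
    then show thesis using that by (metis linorder_neqE)
  qed
  define t where "t = num_streams A"
  define gc where "gc = card (UNIV :: ('a, 'g) cell set)"
  have gc: "0 < gc" unfolding gc_def using finite_cell by (simp add: card_gt_0_iff)
  define \<gamma> where "\<gamma> = real t * ln (real gc)"
  define B where "B = 2 * real t + 2"
  have "1 < B" by (simp add: B_def)
  have "eventually (\<lambda>a. real (m (a ^ 5 * (a ^ 5 + 6))) + 1 \<le> real a powr (1 / 8)) at_top"
    by (rule eventually_polylog_memory[OF m])
  moreover have "eventually (\<lambda>a. real (r (a ^ 5 * (a ^ 5 + 6)) + 1) * ln B \<le> ln (real a) / 4) at_top"
    by (rule eventually_few_passes[OF r \<open>1 < B\<close>])
  \<comment> \<open>Base \<open>B\<close> keeps the number \<open>K\<close> of chains below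
    \<open>a powr (1 / 4)\<close>; base 2 is used to bound the number of passes itself by a multiple
    of \<open>ln a\<close>.\<close>
  moreover have "eventually (\<lambda>a. real (r (a ^ 5 * (a ^ 5 + 6)) + 1) * ln 2 \<le> ln (real a) / 4) at_top"
    by (rule eventually_few_passes[OF r]) simp
  moreover have "eventually (\<lambda>a::nat. real t \<le> real a powr (1 / 8)) at_top" by real_asymp
  moreover have "eventually (\<lambda>a::nat. \<gamma> \<le> real a powr (1 / 8)) at_top" by real_asymp
  moreover have "eventually (\<lambda>a::nat. ln (2 * real t + 3) \<le> real a powr (1 / 8)) at_top" by real_asymp
  moreover have "eventually (\<lambda>a::nat. ln (real a) / 4 / ln 2 \<le> real a powr (1 / 8)) at_top" by real_asymp
  moreover have "eventually (\<lambda>a::nat. 2 * (real a powr (1 / 4)) < real a) at_top" by real_asymp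
  \<comment> \<open>With \<open>y = a powr (1 / 8)\<close>, the number of snapshots has order
    \<open>a powr (9 / 4)\<close> and the bits of one snapshot order \<open>y ^ 3\<close>. The total
    exponent \<open>9 / 4 + 3 / 8 = 21 / 8\<close> stays below 3.\<close>
  moreover have "eventually (\<lambda>a::nat. ln (real (a ^ 5 * (a ^ 5 + 6)) + 2) +
     (real a powr (1 / 4) * (real a * real a + 2 * real a powr (1 / 8) + 3) + 1) *
     (ln 2 + (real a powr (1 / 8) + 1) * (ln 2 + ln (real (a ^ 5 * (a ^ 5 + 6)) + 2) +
        real a powr (1 / 8) * (real a powr (1 / 8) + (real a powr (1 / 8) * ln 2 + real a powr (1 / 8)))) +
      (real a powr (1 / 8) * ln 2 + real a powr (1 / 8))) < real a ^ 3 * ln 2) at_top" by real_asymp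
  moreover note eventually_gt_at_top[of 0]
  ultimately have "eventually (\<lambda>a::nat. False) at_top"
  proof eventually_elim
    case (elim a)
    define n where "n = a ^ 5 * (a ^ 5 + 6)"
    define y where "y = real a powr (1 / 8)"
    define R where "R = r n + 1"
    define K where "K = (2 * t + 2) ^ R"
    define Q where "Q = view_bound gc t (m n)"
    define N where "N = (n + 2) * (1 + (t + 1) * (Q + 1)) ^ R"
    note elim = elim[folded n_def y_def R_def]
    have y: "0 \<le> y" by (simp add: y_def)
    have Q: "0 < Q" using gc by (simp add: Q_def view_bound_def)
    have KB: "real K = B ^ R" by (simp add: K_def B_def ac_simps)
    have Ka: "real K \<le> real a powr (1 / 4)"
    proof -
      have "real K = exp (real R * ln B)" using \<open>1 < B\<close> by (simp add: KB exp_of_nat_mult)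
      also have "\<dots> \<le> exp (ln (real a) / 4)" using elim(2) by simp
      also have "\<dots> = real a powr (1 / 4)" using elim(10) by (simp add: powr_def)
      finally show ?thesis .
    qed
    have "2 * real K < real a" using Ka elim(8) by linarith
    then have "2 * K < a" by linarith
    from counting_bound[OF c mem passes comp, of a, folded n_def, folded t_def R_def gc_def, folded K_def Q_def, folded N_def, OF this]
    have "2 ^ a ^ 3 \<le> (n + 2) * ((N + 1) ^ (t + 1) * Q + 1) ^ (K * (a * a + 2 * t + 3) + 1)" .
    from counting_bound_ln[OF Q this]
    have main: "real (a ^ 3) * ln 2 \<le> ln (real n + 2) + real (K * (a * a + 2 * t + 3) + 1) *
       (ln 2 + (real t + 1) * ln (real N + 1) + ln (real Q))" .
    have lnQ: "ln (real Q) \<le> y * ln 2 + y"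
    proof -
      have "ln (real Q) = (real (m n) + 1) * ln 2 + \<gamma>"
        using gc by (simp add: Q_def view_bound_def \<gamma>_def ln_mult ln_realpow algebra_simps)
      also have "\<dots> \<le> y * ln 2 + y" using elim(1,5) by (intro add_mono mult_right_mono) auto
      finally show ?thesis .
    qed
    have lnQ0: "0 \<le> ln (real Q)" using Q by simp
    have Ry: "real R \<le> y"
    proof -
      have "real R \<le> ln (real a) / 4 / ln 2" using elim(3) by (simp add: field_simps)
      then show ?thesis using elim(7) by linarith
    qed
    have lnN: "ln (real N + 1) \<le> ln 2 + ln (real n + 2) + y * (y + (y * ln 2 + y))"
    proof -
      have "ln (real N + 1) \<le> ln 2 + ln (real n + 2) + real R * (ln (2 * real t + 3) + ln (real Q))"
        unfolding N_def by (rule ln_time_bound[OF Q])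
      also have "real R * (ln (2 * real t + 3) + ln (real Q)) \<le> y * (y + (y * ln 2 + y))"
        using Ry elim(6) lnQ lnQ0 y by (intro mult_mono add_mono) auto
      finally show ?thesis by simp
    qed
    have lnN0: "0 \<le> ln (real N + 1)" by simp
    have "(real t + 1) * ln (real N + 1) \<le> (y + 1) * (ln 2 + ln (real n + 2) + y * (y + (y * ln 2 + y)))"
      using elim(4) lnN lnN0 y by (intro mult_mono) auto
    with lnQ have inner: "ln 2 + (real t + 1) * ln (real N + 1) + ln (real Q) \<le>
       ln 2 + (y + 1) * (ln 2 + ln (real n + 2) + y * (y + (y * ln 2 + y))) + (y * ln 2 + y)" by linarith
    have "real (K * (a * a + 2 * t + 3) + 1) = real K * (real a * real a + 2 * real t + 3) + 1" by simp
    also have "\<dots> \<le> real a powr (1 / 4) * (real a * real a + 2 * y + 3) + 1"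
      using Ka elim(4) y by (intro add_mono mult_mono) auto
    finally have outer: "real (K * (a * a + 2 * t + 3) + 1) \<le> real a powr (1 / 4) * (real a * real a + 2 * y + 3) + 1" .
    have "real (K * (a * a + 2 * t + 3) + 1) * (ln 2 + (real t + 1) * ln (real N + 1) + ln (real Q)) \<le>
      (real a powr (1 / 4) * (real a * real a + 2 * y + 3) + 1) *
      (ln 2 + (y + 1) * (ln 2 + ln (real n + 2) + y * (y + (y * ln 2 + y))) + (y * ln 2 + y))"
      using outer inner lnN0 lnQ0 y by (intro mult_mono) auto
    with main elim(9) show False by simp
  qed
  then show False by simp
qed

end
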